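(* Let $\mathcal{D}\leq\mathbb{F}_2^n$ be a semi self-dual code. Then $$d(\mathcal{D}^{\perp})\leq\begin{cases}4\lfloor n/24\rfloor+2 & \text{if } n\equiv 0,2,4,6,8,10,12,14 \pmod{24},\\ 4\lfloor n/24\rfloor+4 & \text{if } n\equiv 16,18,20\pmod{24},\\ 4\lfloor n/24\rfloor+6 & \text{if } n\equiv 22\pmod{24}.\end{cases}$$ Moreover, if $n=24\mu$ for some integer $\mu$ and either $\mathcal{D}$ is doubly-even or $\binom{5\mu-1}{\mu-1}$ is odd, then $d(\mathcal{D}^\perp)\leq 4\mu$.
   Context: A binary linear code $\mathcal{D}\leq\mathbb{F}_2^n$ is self-orthogonal if $\mathcal{D}\subseteq\mathcal{D}^\perp$ (standard inner product). It is called semi self-dual if it is self-orthogonal, contains the all-ones vector $\mathbf{1}=(1,\dots,1)$, and $\dim(\mathcal{D}^\perp/\mathcal{D})=2$. $d(\mathcal{D}^\perp)$ denotes the minimum Hamming weight of a nonzero word of $\mathcal{D}^\perp$. $\mathcal{D}$ is doubly-even if all its codewords have weight divisible by $4$. *)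

theory Defs
  imports Main "HOL-Library.Z2"
begin

text \<open>Vectors of \<open>F_2^n\<close> are represented as functions \<open>nat \<Rightarrow> bit\<close>
  vanishing outside \<open>{..<n}\<close>.\<close>

definition vecs :: "nat \<Rightarrow> (nat \<Rightarrow> bit) set" where
  "vecs n = {v. \<forall>i\<ge>n. v i = 0}"

definition ones :: "nat \<Rightarrow> (nat \<Rightarrow> bit)" where
  "ones n = (\<lambda>i. if i < n then 1 else 0)"

definition inner :: "nat \<Rightarrow> (nat \<Rightarrow> bit) \<Rightarrow> (nat \<Rightarrow> bit) \<Rightarrow> bit" where
  "inner n v w = (\<Sum>i<n. v i * w i)"

definition wt :: "(nat \<Rightarrow> bit) \<Rightarrow> nat" where
  "wt v = card {i. v i \<noteq> 0}"

definition linear_code :: "nat \<Rightarrow> (nat \<Rightarrow> bit) set \<Rightarrow> bool" where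
  "linear_code n C \<longleftrightarrow> C \<subseteq> vecs n \<and> (\<lambda>_. 0) \<in> C \<and>
     (\<forall>v\<in>C. \<forall>w\<in>C. (\<lambda>i. v i + w i) \<in> C) \<and> (\<forall>c::bit. \<forall>v\<in>C. (\<lambda>i. c * v i) \<in> C)"

definition dual :: "nat \<Rightarrow> (nat \<Rightarrow> bit) set \<Rightarrow> (nat \<Rightarrow> bit) set" where
  "dual n C = {w \<in> vecs n. \<forall>v\<in>C. inner n v w = 0}"

definition self_orthogonal :: "nat \<Rightarrow> (nat \<Rightarrow> bit) set \<Rightarrow> bool" where
  "self_orthogonal n C \<longleftrightarrow> linear_code n C \<and> C \<subseteq> dual n C"

text \<open>\<open>dim(D^\<perp>/D) = 2\<close> over F_2 means \<open>|D^\<perp>| = 4 |D|\<close>.\<close>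
definition semi_self_dual :: "nat \<Rightarrow> (nat \<Rightarrow> bit) set \<Rightarrow> bool" where
  "semi_self_dual n C \<longleftrightarrow> self_orthogonal n C \<and> ones n \<in> C \<and>
     card (dual n C) = 4 * card C"

definition min_dist :: "(nat \<Rightarrow> bit) set \<Rightarrow> nat" where
  "min_dist C = Min {wt v | v. v \<in> C \<and> v \<noteq> (\<lambda>_. 0)}"

definition doubly_even :: "(nat \<Rightarrow> bit) set \<Rightarrow> bool" where
  "doubly_even C \<longleftrightarrow> (\<forall>v\<in>C. 4 dvd wt v)"

end

theory Submission
  imports Defs Complex_Main "HOL-Computational_Algebra.Polynomial_FPS"
begin

text \<open>
  Let \<open>F\<close> and \<open>G\<close> be the weight enumerators of \<open>D\<^sup>\<perp>\<close> and \<open>D\<close>, and let \<open>S\<close> be that of the shadow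
  of \<open>D\<close>, the set of \<open>u\<close> with \<open>(-1)^(u \<cdot> v) \<i>^(wt v) = 1\<close> for all \<open>v \<in> D\<close>. By MacWilliams, both \<open>F\<close> and
  \<open>G\<close> are obtained from \<open>S\<close> by a linear substitution, and with \<open>n = 2N\<close> the combinations \<open>2G - F\<close> and
  \<open>2G + F\<close> see only the shadow weights congruent to \<open>N + 2\<close> and to \<open>N\<close> modulo \<open>4\<close>. As the shadow
  is closed under adding the all-ones vector, pairing \<open>u\<close> with \<open>u + 1\<close> gives, in \<open>Y = y\<^sup>2\<close>,
  \<open>2G - F = (1 - 6Y + Y\<^sup>2) \<Sum>\<^sub>j e\<^sub>j (1 + Y)^(N - 2 - 4j) (Y (1 - Y)\<^sup>2)^j\<close> and
  \<open>2G + F = \<Sum>\<^sub>j c\<^sub>j (1 + Y)^(N - 4j) (Y (1 - Y)\<^sup>2)^j\<close>, where \<open>(-1)^j e\<^sub>j\<close> and \<open>(-1)^j c\<^sub>j\<close> are nonnegative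
  integers times explicit powers of \<open>2\<close>.

  If \<open>D\<^sup>\<perp>\<close> has no nonzero word of weight at most \<open>2r\<close>, then \<open>2G - F = 1 + O(Y^(r + 1))\<close> and
  \<open>2G + F = 3 + O(Y^(r + 1))\<close>, so Lagrange inversion determines \<open>e\<^sub>r\<close> and \<open>c\<^sub>r\<close>. In the first three
  cases the value has the wrong sign (\<open>e\<^sub>r\<close> for odd \<open>r\<close>, \<open>c\<^sub>r\<close> for even \<open>r\<close>). For \<open>n = 24\<mu>\<close> and \<open>r = 2\<mu>\<close> it
  is \<open>e\<^sub>r = 6 binom(5\<mu> - 1, \<mu> - 1)\<close>, while the expansion makes \<open>e\<^sub>r\<close> a multiple of \<open>4\<close>, and \<open>0\<close> if
  \<open>D\<close> is doubly-even, because then the shadow is \<open>D\<^sup>\<perp>\<close>.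
\<close>

subsection \<open>Binary vectors and MacWilliams identities\<close>

declare add_bit_eq_xor [simp del] mult_bit_eq_and [simp del]

lemma bit_add_self [simp]: "b + b = 0" for b :: bit
  by (cases b) auto

lemma bit_neq_0_iff: "b \<noteq> 0 \<longleftrightarrow> b = 1" for b :: bit
  by (cases b) auto

definition bit_sign :: "bit \<Rightarrow> complex" where
  "bit_sign b = (if b = 0 then 1 else -1)"

lemma bit_sign_simps [simp]: "bit_sign 0 = 1" "bit_sign 1 = -1"
  by (simp_all add: bit_sign_def)

lemma bit_sign_add: "bit_sign (a + b) = bit_sign a * bit_sign b"
  by (cases a; cases b) auto

lemma bit_sign_sum: "finite A \<Longrightarrow> bit_sign (sum f A) = (\<Prod>i\<in>A. bit_sign (f i))"
  by (induction A rule: finite_induct) (auto simp: bit_sign_add)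

lemma bit_sign_of_nat: "bit_sign (of_nat k) = (-1) ^ k"
  by (induction k) (auto simp: bit_sign_add)

definition supp :: "(nat \<Rightarrow> bit) \<Rightarrow> nat set" where
  "supp v = {i. v i \<noteq> 0}"

lemma wt_eq_card_supp: "wt v = card (supp v)"
  by (simp add: wt_def supp_def)

lemma supp_subset: "v \<in> vecs n \<Longrightarrow> supp v \<subseteq> {..<n}"
  by (force simp: vecs_def supp_def not_less[symmetric])

lemma finite_supp: "v \<in> vecs n \<Longrightarrow> finite (supp v)"
  using supp_subset finite_subset by blast

lemma wt_le: "v \<in> vecs n \<Longrightarrow> wt v \<le> n"
  using card_mono[OF _ supp_subset] by (fastforce simp: wt_eq_card_supp)

lemma bij_betw_supp: "bij_betw supp (vecs n) (Pow {..<n})"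
proof (rule bij_betw_byWitness[where f' = "\<lambda>A i. if i \<in> A then 1 else 0"])
  show "\<forall>v\<in>vecs n. (\<lambda>i. if i \<in> supp v then 1 else 0) = v"
    by (auto simp: supp_def fun_eq_iff bit_neq_0_iff)
  show "\<forall>A\<in>Pow {..<n}. supp (\<lambda>i. if i \<in> A then 1 else 0) = A"
    by (auto simp: supp_def)
  show "supp ` vecs n \<subseteq> Pow {..<n}"
    using supp_subset by blast
  show "(\<lambda>A i. if i \<in> A then 1 else 0) ` Pow {..<n} \<subseteq> vecs n"
    by (auto simp: vecs_def)
qed

lemma finite_vecs: "finite (vecs n)"
  using bij_betw_finite[OF bij_betw_supp] by simp

lemma ones_in_vecs: "ones n \<in> vecs n"
  by (simp add: ones_def vecs_def)

lemma supp_ones: "supp (ones n) = {..<n}"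
  by (auto simp: supp_def ones_def)

lemma inner_commute: "inner n v w = inner n w v"
  by (simp add: inner_def mult.commute)

lemma inner_add_right: "inner n u (\<lambda>i. v i + w i) = inner n u v + inner n u w"
  by (simp add: inner_def distrib_left sum.distrib)

lemma inner_eq_card:
  assumes "v \<in> vecs n"
  shows "inner n v w = of_nat (card (supp v \<inter> supp w))"
proof -
  have "inner n v w = (\<Sum>i<n. if i \<in> supp v \<inter> supp w then 1 else 0)"
    unfolding inner_def by (intro sum.cong) (auto simp: supp_def bit_neq_0_iff)
  also have "\<dots> = (\<Sum>i\<in>supp v \<inter> supp w. 1)"
    using supp_subset[OF assms] by (intro sum.mono_neutral_cong_right) auto
  finally show ?thesis by simp
qed

lemma wt_add:
  assumes "v \<in> vecs n" "w \<in> vecs n"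
  shows "wt (\<lambda>i. v i + w i) + 2 * card (supp v \<inter> supp w) = wt v + wt w"
proof -
  have fin: "finite (supp v)" "finite (supp w)"
    using assms finite_supp by auto
  have "supp (\<lambda>i. v i + w i) = (supp v - supp w) \<union> (supp w - supp v)"
    by (auto simp: supp_def add_bit_eq_xor)
  then have "wt (\<lambda>i. v i + w i) = card (supp v - supp w) + card (supp w - supp v)"
    using card_Un_disjoint[of "supp v - supp w" "supp w - supp v"] fin
    by (auto simp: wt_eq_card_supp)
  moreover have "card (supp v) = card (supp v - supp w) + card (supp v \<inter> supp w)"
    using fin by (metis card_Diff_subset_Int card_mono finite_Int inf_le1 le_add_diff_inverse2)
  moreover have "card (supp w) = card (supp w - supp v) + card (supp v \<inter> supp w)"
    using fin by (metis card_Diff_subset_Int card_mono finite_Int inf_commute inf_le1 le_add_diff_inverse2)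
  ultimately show ?thesis by (simp add: wt_eq_card_supp)
qed

definition weight_enum :: "nat \<Rightarrow> (nat \<Rightarrow> bit) set \<Rightarrow> complex \<Rightarrow> complex \<Rightarrow> complex" where
  "weight_enum n C x y = (\<Sum>v\<in>C. x ^ (n - wt v) * y ^ wt v)"

text \<open>Expand the product over coordinates of \<open>x + bit_sign (v i) * y\<close>: choosing
  the \<open>y\<close> term exactly on a set \<open>A\<close> gives the summand of the vector with
  support \<open>A\<close>.\<close>

lemma sum_vecs_character:
  assumes v: "v \<in> vecs n"
  shows "(\<Sum>u\<in>vecs n. bit_sign (inner n u v) * (x ^ (n - wt u) * y ^ wt u)) =
         (x + y) ^ (n - wt v) * (x - y) ^ wt v"
proof -
  have sv: "supp v \<subseteq> {..<n}" by (rule supp_subset[OF v])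
  have "(x + y) ^ (n - wt v) * (x - y) ^ wt v =
        (\<Prod>i\<in>{..<n} - supp v. bit_sign (v i) * y + x) * (\<Prod>i\<in>supp v. bit_sign (v i) * y + x)"
  proof -
    have "(\<Prod>i\<in>{..<n} - supp v. bit_sign (v i) * y + x) = (\<Prod>i\<in>{..<n} - supp v. x + y)"
      by (intro prod.cong) (auto simp: supp_def)
    moreover have "(\<Prod>i\<in>supp v. bit_sign (v i) * y + x) = (\<Prod>i\<in>supp v. x - y)"
      by (intro prod.cong) (auto simp: supp_def bit_neq_0_iff)
    ultimately show ?thesis
      using sv finite_supp[OF v] by (simp add: card_Diff_subset wt_eq_card_supp)
  qed
  also have "\<dots> = (\<Prod>i<n. bit_sign (v i) * y + x)"
    using sv by (simp add: prod.subset_diff[of "supp v" "{..<n}"])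
  also have "\<dots> = (\<Sum>A\<in>Pow {..<n}. (\<Prod>i\<in>A. bit_sign (v i) * y) * (\<Prod>i\<in>{..<n} - A. x))"
    by (simp add: prod_add)
  also have "\<dots> = (\<Sum>u\<in>vecs n. (\<Prod>i\<in>supp u. bit_sign (v i) * y) * (\<Prod>i\<in>{..<n} - supp u. x))"
    by (rule sum.reindex_bij_betw[OF bij_betw_supp, symmetric])
  also have "\<dots> = (\<Sum>u\<in>vecs n. bit_sign (inner n u v) * (x ^ (n - wt u) * y ^ wt u))"
  proof (rule sum.cong[OF refl])
    fix u assume u: "u \<in> vecs n"
    have "bit_sign (inner n u v) = (\<Prod>i<n. bit_sign (u i * v i))"
      by (simp add: inner_def bit_sign_sum)
    also have "\<dots> = (\<Prod>i\<in>supp u. bit_sign (v i))"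
      using supp_subset[OF u]
      by (intro prod.mono_neutral_cong_right) (auto simp: supp_def bit_neq_0_iff)
    finally show "(\<Prod>i\<in>supp u. bit_sign (v i) * y) * (\<Prod>i\<in>{..<n} - supp u. x) =
        bit_sign (inner n u v) * (x ^ (n - wt u) * y ^ wt u)"
      using supp_subset[OF u] finite_supp[OF u]
      by (simp add: prod.distrib card_Diff_subset wt_eq_card_supp)
  qed
  finally show ?thesis by simp
qed

text \<open>Orthogonality of characters: translation by a codeword \<open>w\<close> with
  \<open>\<psi> w \<noteq> 1\<close> permutes \<open>D\<close> but multiplies the sum by
  \<open>\<psi> w\<close>.\<close>

lemma sum_character:
  fixes \<psi> :: "(nat \<Rightarrow> bit) \<Rightarrow> complex"
  assumes D: "linear_code n D"
    and mult: "\<And>v w. v \<in> D \<Longrightarrow> w \<in> D \<Longrightarrow> \<psi> (\<lambda>i. v i + w i) = \<psi> v * \<psi> w"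
  shows "(\<Sum>v\<in>D. \<psi> v) = (if \<forall>v\<in>D. \<psi> v = 1 then of_nat (card D) else 0)"
proof (cases "\<forall>v\<in>D. \<psi> v = 1")
  case False
  then obtain w where w: "w \<in> D" "\<psi> w \<noteq> 1" by blast
  have add: "(\<lambda>i. v i + w i) \<in> D" if "v \<in> D" for v
    using D w that by (auto simp: linear_code_def)
  have "bij_betw (\<lambda>v i. v i + w i) D D"
    by (rule bij_betw_byWitness[where f' = "\<lambda>v i. v i + w i"])
       (auto simp: add add.assoc)
  then have "(\<Sum>v\<in>D. \<psi> v) = (\<Sum>v\<in>D. \<psi> (\<lambda>i. v i + w i))"
    by (rule sum.reindex_bij_betw[symmetric])
  also have "\<dots> = (\<Sum>v\<in>D. \<psi> v) * \<psi> w"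
    using w by (simp add: mult sum_distrib_right)
  finally have "(\<Sum>v\<in>D. \<psi> v) = 0" using w by simp
  with False show ?thesis by auto
qed auto

text \<open>Common source of both MacWilliams identities: \<open>\<psi> v = 1\<close> yields the
  dual, \<open>\<psi> v = \<i> ^ wt v\<close> the shadow. After the sums are exchanged, the inner
  sum over \<open>D\<close> is a character sum, which selects the \<open>u\<close> that make the
  product character trivial.\<close>

lemma poisson_summation:
  assumes D: "linear_code n D"
    and mult: "\<And>v w. v \<in> D \<Longrightarrow> w \<in> D \<Longrightarrow> \<psi> (\<lambda>i. v i + w i) = \<psi> v * \<psi> w"
  shows "(\<Sum>v\<in>D. \<psi> v * ((x + y) ^ (n - wt v) * (x - y) ^ wt v)) =
         of_nat (card D) * weight_enum n {u \<in> vecs n. \<forall>v\<in>D. bit_sign (inner n u v) * \<psi> v = 1} x y"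
proof -
  have DV: "D \<subseteq> vecs n" using D by (simp add: linear_code_def)
  let ?T = "{u \<in> vecs n. \<forall>v\<in>D. bit_sign (inner n u v) * \<psi> v = 1}"
  have "(\<Sum>v\<in>D. \<psi> v * ((x + y) ^ (n - wt v) * (x - y) ^ wt v)) =
        (\<Sum>v\<in>D. \<Sum>u\<in>vecs n. \<psi> v * (bit_sign (inner n u v) * (x ^ (n - wt u) * y ^ wt u)))"
    using DV by (intro sum.cong) (auto simp: sum_vecs_character[symmetric] sum_distrib_left)
  also have "\<dots> = (\<Sum>u\<in>vecs n. (\<Sum>v\<in>D. bit_sign (inner n u v) * \<psi> v) * (x ^ (n - wt u) * y ^ wt u))"
    by (subst sum.swap) (simp add: sum_distrib_left sum_distrib_right mult_ac)
  also have "\<dots> = (\<Sum>u\<in>vecs n. if u \<in> ?T then of_nat (card D) * (x ^ (n - wt u) * y ^ wt u) else 0)"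
  proof (rule sum.cong[OF refl])
    fix u assume "u \<in> vecs n"
    then show "(\<Sum>v\<in>D. bit_sign (inner n u v) * \<psi> v) * (x ^ (n - wt u) * y ^ wt u) =
      (if u \<in> ?T then of_nat (card D) * (x ^ (n - wt u) * y ^ wt u) else 0)"
      by (subst sum_character[OF D]) (auto simp: mult inner_add_right bit_sign_add)
  qed
  also have "\<dots> = (\<Sum>u\<in>?T. of_nat (card D) * (x ^ (n - wt u) * y ^ wt u))"
    by (rule sum.mono_neutral_cong_right) (auto simp: finite_vecs)
  finally show ?thesis by (simp add: weight_enum_def sum_distrib_left)
qed

lemma of_nat_bit_eq_0_iff: "(of_nat k :: bit) = 0 \<longleftrightarrow> even k"
proof (cases "even k")
  case True
  then obtain m where "k = m + m" by (metis evenE mult_2)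
  then show ?thesis by simp
next
  case False
  then obtain m where "k = Suc (m + m)" by (metis oddE mult_2 Suc_eq_plus1)
  then show ?thesis by simp
qed

lemma even_iff_mod4:
  fixes N d :: nat
  shows "even d \<longleftrightarrow> (N + 2 * d) mod 4 = N mod 4"
proof -
  have "(N + 2 * d) mod 4 = N mod 4 \<longleftrightarrow> 4 dvd 2 * d"
    using mod_eq_dvd_iff_nat[of N "N + 2 * d" 4] unfolding diff_add_inverse by simp
  also have "\<dots> \<longleftrightarrow> even d" by presburger
  finally show ?thesis by (rule sym)
qed

lemma mod4_reflect:
  fixes k w N :: nat
  assumes "w + k = 2 * N"
  shows "k mod 4 = N mod 4 \<longleftrightarrow> w mod 4 = N mod 4"
proof -
  have eq: "int N - int k = - (int N - int w)" using assms by linarith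
  have "4 dvd int N - int k \<longleftrightarrow> 4 dvd int N - int w"
    unfolding eq by (rule dvd_minus_iff)
  then have "int N mod 4 = int k mod 4 \<longleftrightarrow> int N mod 4 = int w mod 4"
    unfolding mod_eq_dvd_iff .
  then have "int (N mod 4) = int (k mod 4) \<longleftrightarrow> int (N mod 4) = int (w mod 4)"
    unfolding of_nat_mod of_nat_numeral .
  then show ?thesis unfolding of_nat_eq_iff by (simp only: eq_commute[of "N mod 4"])
qed

lemma weight_enum_scale:
  assumes "C \<subseteq> vecs n"
  shows "weight_enum n C (c * x) (c * y) = c ^ n * weight_enum n C x y"
proof -
  have "(c * x) ^ (n - wt v) * (c * y) ^ wt v = c ^ n * (x ^ (n - wt v) * y ^ wt v)" if "v \<in> C" for v
  proof -
    have "wt v \<le> n" using that assms wt_le by blast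
    then have "c ^ n = c ^ (n - wt v) * c ^ wt v" unfolding power_add[symmetric] by simp
    then show ?thesis by (simp only: power_mult_distrib mult_ac)
  qed
  then show ?thesis unfolding weight_enum_def sum_distrib_left by (rule sum.cong[OF refl])
qed

text \<open>The shadow in the sense of Conway and Sloane, carried over from self-dual codes: on a
  self-orthogonal code \<open>\<i> ^ wt v\<close> is itself a character with values \<open>1\<close>
  and \<open>-1\<close>, and the shadow collects the vectors that represent it.\<close>

definition shadow :: "nat \<Rightarrow> (nat \<Rightarrow> bit) set \<Rightarrow> (nat \<Rightarrow> bit) set" where
  "shadow n C = {u \<in> vecs n. \<forall>v\<in>C. bit_sign (inner n u v) * \<i> ^ wt v = 1}"

subsection \<open>Semi self-dual codes and their shadow\<close>

locale semi_self_dual_code =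
  fixes n :: nat and D :: "(nat \<Rightarrow> bit) set"
  assumes ssd: "semi_self_dual n D"
begin

lemma linear: "linear_code n D" and D_subset_dual: "D \<subseteq> dual n D" and ones_in: "ones n \<in> D"
  and card_dual: "card (dual n D) = 4 * card D"
  using ssd by (auto simp: semi_self_dual_def self_orthogonal_def)

lemma D_subset: "D \<subseteq> vecs n" and zero_in: "(\<lambda>_. 0) \<in> D"
  using linear by (auto simp: linear_code_def)

lemma dual_subset: "dual n D \<subseteq> vecs n"
  by (auto simp: dual_def)

lemma shadow_subset: "shadow n D \<subseteq> vecs n"
  by (auto simp: shadow_def)

lemma finite_D: "finite D" and finite_dual: "finite (dual n D)" and finite_shadow: "finite (shadow n D)"
  using finite_subset[OF _ finite_vecs] D_subset dual_subset shadow_subset by auto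

lemma wt_zero_iff: "v \<in> vecs n \<Longrightarrow> wt v = 0 \<longleftrightarrow> v = (\<lambda>_. 0)"
  using finite_supp by (auto simp: wt_eq_card_supp) (auto simp: supp_def)

lemma inner_ones: "v \<in> vecs n \<Longrightarrow> inner n v (ones n) = of_nat (wt v)"
  using supp_subset[of v n] by (simp add: inner_eq_card supp_ones wt_eq_card_supp Int_absorb2)

lemma dual_wt_even:
  assumes "v \<in> dual n D"
  shows "even (wt v)"
proof -
  have "inner n (ones n) v = 0" using assms ones_in by (auto simp: dual_def)
  then show ?thesis
    using inner_ones[of v] assms dual_subset of_nat_bit_eq_0_iff by (auto simp: inner_commute)
qed

lemma even_n: "even n"
  using dual_wt_even[of "ones n"] D_subset_dual ones_in by (auto simp: wt_eq_card_supp supp_ones)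

text \<open>Orthogonal codewords share an even number of ones, so weights add modulo 4. This is what
  makes \<open>\<i> ^ wt v\<close> a character on \<open>D\<close>.\<close>

lemma i_power_wt_add:
  assumes "v \<in> D" "w \<in> D"
  shows "\<i> ^ wt (\<lambda>i. v i + w i) = \<i> ^ wt v * \<i> ^ wt w"
proof -
  have vw: "v \<in> vecs n" "w \<in> vecs n" using assms D_subset by auto
  have "inner n v w = 0" using assms D_subset_dual by (auto simp: dual_def)
  then have "even (card (supp v \<inter> supp w))"
    using inner_eq_card[OF vw(1)] of_nat_bit_eq_0_iff by simp
  then obtain k where "card (supp v \<inter> supp w) = 2 * k" by blast
  with wt_add[OF vw] have "wt v + wt w = wt (\<lambda>i. v i + w i) + 4 * k" by simp
  then have "\<i> ^ (wt v + wt w) = \<i> ^ wt (\<lambda>i. v i + w i) * (\<i> ^ 4) ^ k"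
    by (simp add: power_add power_mult)
  then show ?thesis by (simp add: power_add)
qed

lemma macwilliams:
  "of_nat (card D) * weight_enum n (dual n D) x y = weight_enum n D (x + y) (x - y)"
proof -
  have "dual n D = {u \<in> vecs n. \<forall>v\<in>D. bit_sign (inner n u v) * 1 = 1}"
    by (auto simp: dual_def bit_sign_def inner_commute)
  then show ?thesis
    using poisson_summation[OF linear, of "\<lambda>_. 1" x y] by (simp add: weight_enum_def)
qed

lemma macwilliams_shadow:
  "of_nat (card D) * weight_enum n (shadow n D) x y = weight_enum n D (x + y) (\<i> * (x - y))"
  using poisson_summation[OF linear, of "\<lambda>v. \<i> ^ wt v" x y] i_power_wt_add
  by (simp add: weight_enum_def shadow_def power_mult_distrib mult.left_commute)

text \<open>MacWilliams at \<open>x = y = 1\<close>: the left side is the product of the two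
  cardinalities, and on the right only the zero word survives.\<close>

lemma card_D_square: "4 * card D ^ 2 = 2 ^ n"
proof -
  have "weight_enum n D 2 0 = (\<Sum>v\<in>D. if v = (\<lambda>_. 0) then 2 ^ n else 0)"
    unfolding weight_enum_def
  proof (rule sum.cong[OF refl])
    fix v assume "v \<in> D"
    then have "wt v = 0 \<longleftrightarrow> v = (\<lambda>_. 0)" using wt_zero_iff D_subset by auto
    then show "(2::complex) ^ (n - wt v) * 0 ^ wt v = (if v = (\<lambda>_. 0) then 2 ^ n else 0)"
      by (cases "wt v = 0") auto
  qed
  also have "\<dots> = 2 ^ n" using zero_in finite_D by simp
  finally have "of_nat (4 * card D ^ 2) = (of_nat (2 ^ n) :: complex)"
    using macwilliams[of 1 1] by (simp add: weight_enum_def card_dual power2_eq_square mult_ac)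
  then show ?thesis by (rule of_nat_eq_iff[THEN iffD1])
qed

end

locale semi_self_dual_half_length = semi_self_dual_code +
  fixes N :: nat
  assumes n_eq: "n = 2 * N"
begin

lemma two_card_D: "2 * card D = 2 ^ N"
proof -
  have "(2 * card D) ^ 2 = (2 ^ N) ^ 2"
    using card_D_square by (simp add: n_eq power_mult power_even_eq[symmetric] power_mult_distrib)
  then show ?thesis by (rule power_eq_imp_eq_base) auto
qed

text \<open>Makes the truncated subtractions \<open>N - 2\<close> below genuine. For smaller
  \<open>N\<close> the cardinality leaves no room for both the zero word and the all-ones
  vector.\<close>

lemma N_ge_2: "N \<ge> 2"
proof (rule ccontr)
  assume "\<not> N \<ge> 2"
  then have "N = 0 \<or> N = 1" by auto
  with two_card_D have N: "N = 1" "card D = 1" by auto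
  then have "ones n = (\<lambda>_. 0)"
    using ones_in zero_in card_1_singletonE by (metis singletonD)
  then show False
    using n_eq N by (auto simp: ones_def dest: fun_cong[of _ _ 0])
qed

text \<open>Inverts \<open>macwilliams_shadow\<close>: the arguments \<open>x + \<i> * y\<close> and
  \<open>x - \<i> * y\<close> have sum \<open>2 * x\<close>, and \<open>\<i>\<close> times the
  second minus the first is \<open>2 * y\<close>; homogeneity removes the \<open>2\<close>.\<close>

lemma weight_enum_D:
  "2 * 2 ^ N * weight_enum n D x y = weight_enum n (shadow n D) (x - \<i> * y) (x + \<i> * y)"
proof -
  have "of_nat (card D) * weight_enum n (shadow n D) (x - \<i> * y) (x + \<i> * y) =
        weight_enum n D (2 * x) (2 * y)"
    by (subst macwilliams_shadow) (simp add: algebra_simps)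
  then have "of_nat (2 * card D) * weight_enum n (shadow n D) (x - \<i> * y) (x + \<i> * y) =
        2 * 2 ^ n * weight_enum n D x y"
    by (simp add: weight_enum_scale[OF D_subset])
  moreover have "(2::complex) ^ n = 2 ^ N * 2 ^ N"
    unfolding n_eq by (simp add: mult_2 power_add)
  ultimately have "2 ^ N * weight_enum n (shadow n D) (x - \<i> * y) (x + \<i> * y) =
        2 ^ N * (2 * 2 ^ N * weight_enum n D x y)"
    unfolding two_card_D by (simp only: of_nat_power of_nat_numeral mult_ac)
  then show ?thesis by simp
qed

lemma weight_enum_dual:
  "4 ^ N * weight_enum n (dual n D) 1 y =
   weight_enum n (shadow n D) ((1 - \<i>) * (1 + \<i> * y)) ((1 + \<i>) * (1 - \<i> * y))"
proof -
  have "2 ^ N * (of_nat (2 * card D) * weight_enum n (dual n D) 1 y) =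
        2 * 2 ^ N * weight_enum n D (1 + y) (1 - y)"
    using macwilliams[of 1 y] by simp
  also have "\<dots> = weight_enum n (shadow n D) ((1 - \<i>) * (1 + \<i> * y)) ((1 + \<i>) * (1 - \<i> * y))"
    by (subst weight_enum_D) (simp add: algebra_simps)
  finally show ?thesis
    unfolding two_card_D by (simp add: mult.assoc[symmetric] power_mult_distrib[symmetric])
qed

lemma shadow_wt_parity:
  assumes "u \<in> shadow n D"
  shows "even (wt u + N)"
proof -
  have "bit_sign (inner n u (ones n)) * \<i> ^ wt (ones n) = 1"
    using assms ones_in by (auto simp: shadow_def)
  then have "(-1) ^ wt u * \<i> ^ (2 * N) = 1"
    using assms shadow_subset
    by (auto simp: inner_ones bit_sign_of_nat wt_eq_card_supp supp_ones n_eq[symmetric])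
  then have "(-1 :: complex) ^ (wt u + N) = 1"
    by (simp add: power_mult power_add)
  then show ?thesis by (cases "even (wt u + N)") auto
qed

lemma wt_add_ones:
  assumes "u \<in> vecs n"
  shows "wt (\<lambda>i. u i + ones n i) = n - wt u"
  using wt_add[OF assms ones_in_vecs] supp_subset[OF assms] wt_le[OF assms]
  by (simp add: supp_ones Int_absorb2 wt_eq_card_supp)

lemma shadow_add_ones:
  assumes "u \<in> shadow n D"
  shows "(\<lambda>i. u i + ones n i) \<in> shadow n D"
proof -
  have "bit_sign (inner n (\<lambda>i. u i + ones n i) v) = bit_sign (inner n u v)" if "v \<in> D" for v
  proof -
    have "inner n v (ones n) = 0"
      using that D_subset_dual ones_in by (auto simp: dual_def)
    then show ?thesis
      by (simp add: inner_commute[of n _ v] inner_add_right)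
  qed
  then show ?thesis
    using assms ones_in_vecs[of n] by (auto simp: shadow_def vecs_def)
qed

lemma sum_shadow_reflect:
  fixes h :: "nat \<Rightarrow> complex"
  shows "(\<Sum>u | u \<in> shadow n D \<and> p (wt u). h (wt u)) =
         (\<Sum>u | u \<in> shadow n D \<and> p (n - wt u). h (n - wt u))"
proof (rule sum.reindex_bij_witness[where i = "\<lambda>u i. u i + ones n i" and j = "\<lambda>u i. u i + ones n i"])
  fix u
  have *: "n - (n - wt u) = wt u" if "u \<in> shadow n D"
    using that shadow_subset wt_le by (metis diff_diff_cancel subsetD)
  show "u \<in> {u \<in> shadow n D. p (wt u)} \<Longrightarrow> (\<lambda>i. u i + ones n i) \<in> {u \<in> shadow n D. p (n - wt u)}"
    using * shadow_subset by (auto simp: shadow_add_ones wt_add_ones subset_iff)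
  show "u \<in> {u \<in> shadow n D. p (wt u)} \<Longrightarrow> h (n - wt (\<lambda>i. u i + ones n i)) = h (wt u)"
    using * shadow_subset by (auto simp: wt_add_ones subset_iff)
  show "u \<in> {u \<in> shadow n D. p (n - wt u)} \<Longrightarrow> (\<lambda>i. u i + ones n i) \<in> {u \<in> shadow n D. p (wt u)}"
    using shadow_subset by (auto simp: shadow_add_ones wt_add_ones subset_iff)
qed (auto simp: add.assoc)

text \<open>Pair off factors \<open>(1 - \<i>) * (1 + \<i>) = 2\<close>. With \<open>2 * d\<close>
  the distance from \<open>w\<close> to \<open>N\<close>, the factors left over form the power
  \<open>2 * d\<close> of \<open>2 * \<i>\<close> or of its negative, so the sign is
  \<open>(-1) ^ d\<close>.\<close>

lemma gaussian_power:
  assumes "w \<le> n" "even (w + N)"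
  shows "(1 - \<i>) ^ (n - w) * (1 + \<i>) ^ w = (if w mod 4 = N mod 4 then 2 ^ N else - (2 ^ N))"
proof -
  have sq: "(1 - \<i>) ^ 2 = - (2 * \<i>)" "(1 + \<i>) ^ 2 = 2 * \<i>" "(1 - \<i>) * (1 + \<i>) = 2"
    by (simp_all add: power2_eq_square algebra_simps)
  have i2: "\<i> ^ (2 * d) = (-1) ^ d" for d by (simp add: power_mult)
  show ?thesis
  proof (cases "w \<le> N")
    case True
    then have "even (N - w)" using assms(2) by presburger
    then obtain d where "N - w = 2 * d" by blast
    with True have d: "N = w + 2 * d" "n - w = w + 2 * (2 * d)" using n_eq by auto
    have "(1 - \<i>) ^ (n - w) * (1 + \<i>) ^ w = ((1 - \<i>) * (1 + \<i>)) ^ w * ((1 - \<i>) ^ 2) ^ (2 * d)"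
      unfolding d(2) power_add power_mult power_mult_distrib by (simp only: mult_ac)
    also have "\<dots> = 2 ^ N * (-1) ^ d"
    proof -
      have "(- (2 * \<i>)) ^ (2 * d) = (2 * \<i>) ^ (2 * d)" by simp
      then show ?thesis
        unfolding sq d(1) power_add by (simp only: power_mult_distrib i2) (simp only: mult_ac)
    qed
    moreover have "even d \<longleftrightarrow> w mod 4 = N mod 4"
      using even_iff_mod4[of d w] d(1) by metis
    ultimately show ?thesis by (cases "even d") simp_all
  next
    case False
    then have "even (w - N)" using assms(2) by presburger
    then obtain d where "w - N = 2 * d" by blast
    with False have d: "w = N + 2 * d" by auto
    define k where "k = n - w"
    have wk: "w = k + 2 * (2 * d)" "N = k + 2 * d" using d n_eq assms(1) by (auto simp: k_def)
    have "(1 - \<i>) ^ k * (1 + \<i>) ^ w = ((1 - \<i>) * (1 + \<i>)) ^ k * ((1 + \<i>) ^ 2) ^ (2 * d)"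
      unfolding wk(1) power_add power_mult power_mult_distrib by (simp only: mult_ac)
    also have "\<dots> = 2 ^ N * (-1) ^ d"
      unfolding sq wk(2) power_add power_mult_distrib i2 by (simp only: mult_ac)
    moreover have "even d \<longleftrightarrow> w mod 4 = N mod 4"
      using even_iff_mod4[of d N] d by metis
    ultimately show ?thesis unfolding k_def[symmetric] by (cases "even d") simp_all
  qed
qed

lemma weight_enum_dual_signed:
  "2 ^ N * weight_enum n (dual n D) 1 y =
   (\<Sum>u\<in>shadow n D. (if wt u mod 4 = N mod 4 then 1 else -1) *
       ((1 - \<i> * y) ^ (n - wt u) * (1 + \<i> * y) ^ wt u))"
proof -
  define e :: "nat \<Rightarrow> complex" where "e w = (if w mod 4 = N mod 4 then 1 else -1)" for w
  have e: "e (n - wt u) = e (wt u)" "n - (n - wt u) = wt u" if "u \<in> shadow n D" for u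
  proof -
    have "wt u \<le> n" "even (wt u + N)"
      using that wt_le shadow_subset shadow_wt_parity by auto
    then show "e (n - wt u) = e (wt u)" "n - (n - wt u) = wt u"
      using mod4_reflect[of "wt u" "n - wt u" N] n_eq by (auto simp: e_def)
  qed
  have "4 ^ N * weight_enum n (dual n D) 1 y =
    (\<Sum>u\<in>shadow n D. 2 ^ N * (e (wt u) * ((1 + \<i> * y) ^ (n - wt u) * (1 - \<i> * y) ^ wt u)))"
    unfolding weight_enum_dual
    unfolding weight_enum_def
  proof (rule sum.cong[OF refl])
    fix u assume u: "u \<in> shadow n D"
    have "(1 - \<i>) ^ (n - wt u) * (1 + \<i>) ^ wt u = 2 ^ N * e (wt u)"
      using gaussian_power[of "wt u"] u wt_le shadow_subset shadow_wt_parity by (auto simp: e_def)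
    moreover have "((1 - \<i>) * (1 + \<i> * y)) ^ (n - wt u) * ((1 + \<i>) * (1 - \<i> * y)) ^ wt u =
      ((1 - \<i>) ^ (n - wt u) * (1 + \<i>) ^ wt u) * ((1 + \<i> * y) ^ (n - wt u) * (1 - \<i> * y) ^ wt u)"
      by (simp only: power_mult_distrib mult_ac)
    ultimately show "((1 - \<i>) * (1 + \<i> * y)) ^ (n - wt u) * ((1 + \<i>) * (1 - \<i> * y)) ^ wt u =
      2 ^ N * (e (wt u) * ((1 + \<i> * y) ^ (n - wt u) * (1 - \<i> * y) ^ wt u))"
      by (simp only: mult.assoc)
  qed
  also have "\<dots> = 2 ^ N * (\<Sum>u\<in>shadow n D. e (wt u) * ((1 + \<i> * y) ^ (n - wt u) * (1 - \<i> * y) ^ wt u))"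
    by (simp add: sum_distrib_left)
  \<comment> \<open>Reflection exchanges the roles of \<open>1 + \<i> * y\<close> and
    \<open>1 - \<i> * y\<close>, so that the summands match those of the enumerator of
    \<open>D\<close> up to sign.\<close>
  also have "(\<Sum>u\<in>shadow n D. e (wt u) * ((1 + \<i> * y) ^ (n - wt u) * (1 - \<i> * y) ^ wt u)) =
     (\<Sum>u\<in>shadow n D. e (n - wt u) * ((1 + \<i> * y) ^ (n - (n - wt u)) * (1 - \<i> * y) ^ (n - wt u)))"
    using sum_shadow_reflect[where p = "\<lambda>_. True" and h = "\<lambda>w. e w * ((1 + \<i> * y) ^ (n - w) * (1 - \<i> * y) ^ w)"]
    by simp
  also have "\<dots> = (\<Sum>u\<in>shadow n D. e (wt u) * ((1 - \<i> * y) ^ (n - wt u) * (1 + \<i> * y) ^ wt u))"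
    using e by (intro sum.cong) (auto simp: mult.commute)
  finally have "2 ^ N * (2 ^ N * weight_enum n (dual n D) 1 y) = 2 ^ N * \<dots>"
    by (simp add: mult.assoc[symmetric] power_mult_distrib[symmetric])
  then show ?thesis by (simp add: e_def)
qed

end

subsection \<open>Symmetric polynomials with natural coefficients\<close>

text \<open>For \<open>A = (1 + \<i> * y) ^ 4\<close> and \<open>B = (1 - \<i> * y) ^ 4\<close> the
  generators \<open>A * B\<close> and \<open>(A - B) ^ 2\<close> become \<open>(1 + Y) ^ 4\<close>
  and \<open>-64 * Y * (1 - Y) ^ 2\<close>. Coefficients in \<open>nat\<close> preserve both the
  signs and the integrality used at the end.\<close>

definition symmetric_cone :: "nat \<Rightarrow> (complex \<Rightarrow> complex \<Rightarrow> complex) \<Rightarrow> bool" where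
  "symmetric_cone s f \<longleftrightarrow> (\<exists>c :: nat \<Rightarrow> nat. \<forall>A B.
     f A B = (\<Sum>j\<le>s. of_nat (c j) * (A * B) ^ (s - j) * ((A - B) ^ 2) ^ j))"

lemma symmetric_cone_of_nat: "symmetric_cone 0 (\<lambda>A B. of_nat k)"
  unfolding symmetric_cone_def by (rule exI[of _ "\<lambda>_. k"]) simp

lemma symmetric_cone_add:
  assumes "symmetric_cone s f" "symmetric_cone s g"
  shows "symmetric_cone s (\<lambda>A B. f A B + g A B)"
proof -
  obtain c d :: "nat \<Rightarrow> nat" where
    "\<And>A B. f A B = (\<Sum>j\<le>s. of_nat (c j) * (A * B) ^ (s - j) * ((A - B) ^ 2) ^ j)"
    "\<And>A B. g A B = (\<Sum>j\<le>s. of_nat (d j) * (A * B) ^ (s - j) * ((A - B) ^ 2) ^ j)"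
    using assms unfolding symmetric_cone_def by blast
  then show ?thesis
    unfolding symmetric_cone_def
    by (intro exI[of _ "\<lambda>j. c j + d j"]) (simp add: sum.distrib distrib_right)
qed

lemma symmetric_cone_mult_prod:
  assumes "symmetric_cone s f"
  shows "symmetric_cone (Suc s) (\<lambda>A B. A * B * f A B)"
proof -
  obtain c :: "nat \<Rightarrow> nat" where c:
    "\<And>A B. f A B = (\<Sum>j\<le>s. of_nat (c j) * (A * B) ^ (s - j) * ((A - B) ^ 2) ^ j)"
    using assms unfolding symmetric_cone_def by blast
  have "A * B * f A B = (\<Sum>j\<le>Suc s. of_nat (if j \<le> s then c j else 0) *
      (A * B) ^ (Suc s - j) * ((A - B) ^ 2) ^ j)" for A B
    unfolding c sum_distrib_left sum.atMost_Suc
    by (simp add: Suc_diff_le mult_ac)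
  then show ?thesis
    unfolding symmetric_cone_def by (intro exI[of _ "\<lambda>j. if j \<le> s then c j else 0"] allI)
qed

lemma symmetric_cone_mult_diff:
  assumes "symmetric_cone s f"
  shows "symmetric_cone (Suc s) (\<lambda>A B. (A - B) ^ 2 * f A B)"
proof -
  obtain c :: "nat \<Rightarrow> nat" where c:
    "\<And>A B. f A B = (\<Sum>j\<le>s. of_nat (c j) * (A * B) ^ (s - j) * ((A - B) ^ 2) ^ j)"
    using assms unfolding symmetric_cone_def by blast
  have "(A - B) ^ 2 * f A B = (\<Sum>j\<le>Suc s. of_nat (case j of 0 \<Rightarrow> 0 | Suc i \<Rightarrow> c i) *
      (A * B) ^ (Suc s - j) * ((A - B) ^ 2) ^ j)" for A B
    unfolding c sum_distrib_left by (subst sum.atMost_Suc_shift) (simp add: mult_ac)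
  then show ?thesis
    unfolding symmetric_cone_def by (intro exI[of _ "case_nat 0 c"] allI)
qed

text \<open>The recurrence is the one satisfied by \<open>A ^ (2 * s)\<close> and \<open>B ^ (2 * s)\<close>. Its minus sign
  disappears once the differences \<open>p (Suc s) - A * B * p s\<close> are carried along.\<close>

lemma symmetric_cone_recurrence:
  assumes p0: "symmetric_cone 0 (p 0)"
    and p1: "\<And>A B. p (Suc 0) A B = A * B * p 0 A B + (A - B) ^ 2"
    and rec: "\<And>s A B. p (Suc (Suc s)) A B =
      ((A - B) ^ 2 + 2 * (A * B)) * p (Suc s) A B - (A * B) ^ 2 * p s A B"
  shows "symmetric_cone s (p s)"
proof -
  define d where "d s A B = p (Suc s) A B - A * B * p s A B" for s A B
  have "symmetric_cone s (p s) \<and> symmetric_cone (Suc s) (d s)"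
  proof (induction s)
    case 0
    have "d 0 = (\<lambda>A B. (A - B) ^ 2 * of_nat 1)"
      by (simp add: d_def p1 fun_eq_iff)
    then show ?case
      using p0 symmetric_cone_mult_diff[OF symmetric_cone_of_nat, of 1] by simp
  next
    case (Suc s)
    have p_Suc: "p (Suc s) = (\<lambda>A B. A * B * p s A B + d s A B)"
      by (simp add: d_def fun_eq_iff)
    have p: "symmetric_cone (Suc s) (p (Suc s))"
      unfolding p_Suc using Suc by (intro symmetric_cone_add symmetric_cone_mult_prod) auto
    have d_Suc: "d (Suc s) = (\<lambda>A B. (A - B) ^ 2 * p (Suc s) A B + A * B * d s A B)"
      by (simp add: d_def fun_eq_iff rec power2_eq_square algebra_simps)
    have "symmetric_cone (Suc (Suc s)) (d (Suc s))"
      unfolding d_Suc using Suc p by (intro symmetric_cone_add symmetric_cone_mult_diff symmetric_cone_mult_prod) auto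
    with p show ?case ..
  qed
  then show ?thesis by blast
qed

lemma symmetric_cone_even_powers:
  "symmetric_cone s (\<lambda>A B. A ^ (2 * s) + B ^ (2 * s))"
proof (rule symmetric_cone_recurrence[of "\<lambda>s A B. A ^ (2 * s) + B ^ (2 * s)"])
  show "symmetric_cone 0 (\<lambda>A B. A ^ (2 * 0) + B ^ (2 * 0))"
    using symmetric_cone_of_nat[of 2] by simp
qed (simp_all add: power2_eq_square algebra_simps)

text \<open>The quotient of \<open>A ^ (2 * s + 1) + B ^ (2 * s + 1)\<close> by
  \<open>A + B\<close>, given by a recurrence so that it is also meaningful where
  \<open>A + B = 0\<close>.\<close>

fun odd_power_quotient :: "nat \<Rightarrow> complex \<Rightarrow> complex \<Rightarrow> complex" where
  "odd_power_quotient 0 A B = 1"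
| "odd_power_quotient (Suc 0) A B = A * B + (A - B) ^ 2"
| "odd_power_quotient (Suc (Suc s)) A B =
     ((A - B) ^ 2 + 2 * (A * B)) * odd_power_quotient (Suc s) A B - (A * B) ^ 2 * odd_power_quotient s A B"

lemma odd_power_quotient: "A ^ (2 * s + 1) + B ^ (2 * s + 1) = (A + B) * odd_power_quotient s A B"
proof (induction s A B rule: odd_power_quotient.induct)
  case (3 s A B)
  have "(A + B) * odd_power_quotient (Suc (Suc s)) A B =
      ((A - B) ^ 2 + 2 * (A * B)) * ((A + B) * odd_power_quotient (Suc s) A B) -
      (A * B) ^ 2 * ((A + B) * odd_power_quotient s A B)"
    by (simp add: algebra_simps)
  then show ?case
    unfolding "3"[symmetric] by (simp add: power2_eq_square algebra_simps)
qed (simp_all add: power2_eq_square algebra_simps)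

lemma symmetric_cone_odd_power_quotient: "symmetric_cone s (odd_power_quotient s)"
proof (rule symmetric_cone_recurrence)
  have "odd_power_quotient 0 = (\<lambda>A B. of_nat 1)" by (simp add: fun_eq_iff)
  then show "symmetric_cone 0 (odd_power_quotient 0)" by (simp only: symmetric_cone_of_nat)
qed simp_all

subsection \<open>Lagrange inversion\<close>

text \<open>With \<open>\<phi> = X (1 - X)^2 / (1 + X)^4\<close>, the series in which the
  enumerators are expanded, \<open>q / (a * b)\<close> is the logarithmic derivative
  \<open>X \<phi>' / \<phi>\<close>, the Jacobian factor of Lagrange inversion.\<close>

context
  fixes a b q :: "real fps"
  defines "a \<equiv> 1 + fps_X" and "b \<equiv> 1 - fps_X" and "q \<equiv> 1 - 6 * fps_X + fps_X ^ 2"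
begin

lemma unit_a: "a * inverse a = 1" and unit_b: "b * inverse b = 1"
  by (simp_all add: a_def b_def inverse_mult_eq_1')

text \<open>The series is \<open>F - X F' / l\<close> for \<open>F = a ^ (4 * l) / b ^ (2 * l)\<close>.\<close>

lemma lagrange_vanish:
  assumes "l > 0"
  shows "fps_nth (q * a ^ (4 * l) * inverse a * inverse b ^ (2 * l + 1)) l = 0"
proof -
  define c d where "c = inverse a" and "d = inverse b"
  have ac: "a * c = 1" and bd: "b * d = 1"
    using unit_a unit_b by (simp_all add: c_def d_def)
  obtain k where k: "4 * l = Suc k" using assms by (cases l) auto
  define F where "F = a ^ (4 * l) * d ^ (2 * l)"
  have da: "fps_deriv a = 1"
    by (simp add: a_def)
  have dd: "fps_deriv d = d ^ 2"
    by (simp add: d_def b_def fps_inverse_deriv)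
  have "d ^ (2 * l - 1) * d ^ 2 = d ^ (2 * l + 1)"
    using assms by (subst power_add[symmetric]) (simp add: numeral_eq_Suc)
  moreover have "fps_deriv (d ^ (2 * l)) = of_nat (2 * l) * (d ^ (2 * l - 1) * d ^ 2)"
    by (simp only: fps_deriv_power dd fps_of_nat mult_ac)
  moreover have "fps_deriv (a ^ (4 * l)) = of_nat (4 * l) * a ^ k"
    by (simp only: fps_deriv_power da k fps_of_nat diff_Suc_1 mult_1_right)
  ultimately have F': "fps_deriv F = of_nat (4 * l) * a ^ k * d ^ (2 * l) + a ^ (4 * l) * (of_nat (2 * l) * d ^ (2 * l + 1))"
    by (simp add: F_def)
  have ak: "a ^ (4 * l) = a * a ^ k"
    unfolding k by simp
  have d1: "d ^ (2 * l) = d ^ (2 * l + 1) * b"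
    using bd by (simp add: mult_ac)
  have "of_nat l * F - fps_X * fps_deriv F =
        of_nat l * (a ^ k * d ^ (2 * l + 1)) * (a * b - 4 * fps_X * b - 2 * fps_X * a)"
    unfolding F' unfolding F_def d1 ak of_nat_mult by (simp add: algebra_simps)
  also have "a * b - 4 * fps_X * b - 2 * fps_X * a = q"
    by (simp add: a_def b_def q_def power2_eq_square algebra_simps)
  also have "a ^ k = a ^ (4 * l) * c"
    unfolding ak using ac by (simp add: mult_ac)
  finally have "of_nat l * F - fps_X * fps_deriv F = of_nat l * (q * a ^ (4 * l) * c * d ^ (2 * l + 1))"
    by (simp add: mult_ac)
  moreover have "fps_nth (of_nat l * F - fps_X * fps_deriv F) l = 0"
    using assms by (simp add: fps_of_nat[symmetric])
  ultimately show ?thesis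
    using assms by (simp add: fps_of_nat[symmetric] c_def d_def)
qed

text \<open>Against this kernel the \<open>j\<close>-th summand becomes \<open>X^j\<close> times the
  series of \<open>lagrange_vanish\<close> with \<open>l = r - j\<close>. Its coefficient at
  \<open>r\<close> vanishes for \<open>j < r\<close> by that lemma and for \<open>j > r\<close> by
  order, so only \<open>j = r\<close> remains.\<close>

lemma lagrange_extract:
  fixes e :: "nat \<Rightarrow> real"
  assumes "4 * J \<le> M"
  shows "fps_nth (q * (\<Sum>j\<le>J. fps_const (e j) * a ^ (M - 4 * j) * (fps_X * b ^ 2) ^ j) *
           a ^ (4 * r) * inverse a ^ (M + 1) * inverse b ^ (2 * r + 1)) r = (if r \<le> J then e r else 0)"
proof -
  define c d where "c = inverse a" and "d = inverse b"
  have ac: "a * c = 1" and bd: "b * d = 1"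
    using unit_a unit_b by (simp_all add: c_def d_def)
  have acm: "a ^ i * c ^ i = 1" "b ^ i * d ^ i = 1" for i
    using ac bd by (simp_all add: power_mult_distrib[symmetric])
  define t where "t j = q * (a ^ (M - 4 * j) * (fps_X * b ^ 2) ^ j) * a ^ (4 * r) * c ^ (M + 1) * d ^ (2 * r + 1)" for j
  have t: "fps_nth (t j) r = (if j = r then 1 else 0)" if "j \<le> J" for j
  proof (cases "j \<le> r")
    case False
    have "t j = fps_X ^ j * (q * a ^ (M - 4 * j) * (b ^ 2) ^ j * a ^ (4 * r) * c ^ (M + 1) * d ^ (2 * r + 1))"
      unfolding t_def power_mult_distrib by (simp only: mult_ac)
    then show ?thesis using False by (simp add: fps_X_power_mult_nth)
  next
    case True
    define l where "l = r - j"
    have r: "r = j + l" using True by (simp add: l_def)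
    have M: "M = (M - 4 * j) + 4 * j" using that assms by simp
    have "t j = fps_X ^ j * (q * a ^ (4 * l) * c * d ^ (2 * l + 1)) *
        ((a ^ (M - 4 * j) * a ^ (4 * j)) * c ^ M) * (b ^ (2 * j) * d ^ (2 * j))"
      unfolding t_def power_mult_distrib r
        distrib_left power_add power_one_right power_mult[symmetric]
      by (simp only: mult_ac)
    also have "a ^ (M - 4 * j) * a ^ (4 * j) = a ^ M"
      unfolding power_add[symmetric] using M by simp
    finally have "t j = fps_X ^ j * (q * a ^ (4 * l) * c * d ^ (2 * l + 1))"
      by (simp add: acm)
    then have "fps_nth (t j) r = fps_nth (q * a ^ (4 * l) * c * d ^ (2 * l + 1)) l"
      using r by (simp add: fps_X_power_mult_nth)
    also have "\<dots> = (if l = 0 then 1 else 0)"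
    proof (cases "l = 0")
      case True
      then show ?thesis by (simp add: q_def c_def d_def a_def b_def)
    next
      case False
      then show ?thesis using lagrange_vanish[of l] by (simp add: c_def d_def)
    qed
    finally show ?thesis using r by simp
  qed
  have "q * (\<Sum>j\<le>J. fps_const (e j) * a ^ (M - 4 * j) * (fps_X * b ^ 2) ^ j) *
      a ^ (4 * r) * c ^ (M + 1) * d ^ (2 * r + 1) = (\<Sum>j\<le>J. fps_const (e j) * t j)"
    unfolding t_def sum_distrib_left sum_distrib_right by (simp only: mult_ac)
  then show ?thesis
    by (simp add: c_def[symmetric] d_def[symmetric] fps_sum_nth t if_distrib[of "\<lambda>x. _ * x"] cong: if_cong)
qed

end

text \<open>The coefficients of \<open>(1 - X\<^sup>2) ^ - (k + 1)\<close>.\<close>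

definition even_geom :: "nat \<Rightarrow> real fps" where
  "even_geom k = Abs_fps (\<lambda>i. if even i then of_nat ((k + i div 2) choose k) else 0)"

lemma even_geom_nth: "fps_nth (even_geom k) i = (if even i then of_nat ((k + i div 2) choose k) else 0)"
  by (simp add: even_geom_def)

lemma even_geom_0: "(1 - fps_X ^ 2) * even_geom 0 = 1"
  by (rule fps_ext) (auto simp: left_diff_distrib fps_X_power_mult_nth even_geom_nth not_less)

lemma even_geom_Suc: "(1 - fps_X ^ 2) * even_geom (Suc k) = even_geom k"
proof (rule fps_ext)
  fix i
  show "fps_nth ((1 - fps_X ^ 2) * even_geom (Suc k)) i = fps_nth (even_geom k) i"
  proof (cases "i < 2")
    case True
    then have "i = 0 \<or> i = 1" by auto
    then show ?thesis by (auto simp: left_diff_distrib fps_X_power_mult_nth even_geom_nth)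
  next
    case False
    then obtain j where i: "i = Suc (Suc j)" by (metis add_2_eq_Suc le_add_diff_inverse not_less)
    show ?thesis
      by (auto simp: left_diff_distrib fps_X_power_mult_nth even_geom_nth i)
  qed
qed

lemma even_geom: "(1 - fps_X ^ 2) ^ (k + 1) * even_geom k = 1"
proof (induction k)
  case (Suc k)
  have "(1 - fps_X ^ 2) ^ (Suc k + 1) * even_geom (Suc k) =
        (1 - fps_X ^ 2) ^ (k + 1) * ((1 - fps_X ^ 2) * even_geom (Suc k))"
    by (simp add: mult_ac)
  then show ?case by (simp only: even_geom_Suc Suc)
qed (simp add: even_geom_0)

text \<open>Write \<open>1 / (1 - X)\<close> as \<open>(1 + X) / (1 - X^2)\<close>. The hypothesis
  says that the resulting net exponent \<open>e\<close> of \<open>1 + X\<close> is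
  nonnegative.\<close>

lemma power_ratio_eq_even_geom:
  assumes "s + (k + 1) = e + u"
  shows "(1 + fps_X) ^ s * inverse (1 + fps_X) ^ u * inverse (1 - fps_X) ^ (k + 1) =
         (1 + fps_X) ^ e * even_geom k"
proof -
  define a b c d :: "real fps" where "a = 1 + fps_X" and "b = 1 - fps_X"
    and "c = inverse a" and "d = inverse b"
  have ac: "a ^ i * c ^ i = 1" and bd: "b ^ i * d ^ i = 1" for i
    using unit_a unit_b
    by (simp_all add: c_def d_def a_def b_def power_mult_distrib[symmetric])
  have "1 - fps_X ^ 2 = a * b"
    by (simp add: a_def b_def power2_eq_square algebra_simps)
  then have G: "a ^ (k + 1) * b ^ (k + 1) * even_geom k = 1"
    using even_geom[of k] by (simp only: power_mult_distrib)
  have "a ^ s * c ^ u * d ^ (k + 1) = a ^ s * c ^ u * d ^ (k + 1) * (a ^ (k + 1) * b ^ (k + 1) * even_geom k)"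
    unfolding G by simp
  also have "\<dots> = a ^ (s + (k + 1)) * c ^ u * even_geom k * (b ^ (k + 1) * d ^ (k + 1))"
    unfolding power_add[of a s] by (simp only: mult_ac)
  also have "\<dots> = a ^ e * even_geom k * (a ^ u * c ^ u)"
    unfolding assms bd power_add[of a e] by (simp only: mult_ac mult_1_left)
  finally show ?thesis
    unfolding ac by (simp add: a_def b_def c_def d_def)
qed

text \<open>The odd coefficients of \<open>even_geom\<close> vanish; a single factor
  \<open>1 + X\<close> fills these gaps, and further factors keep everything positive.\<close>

lemma power_mult_even_geom_nth_pos:
  assumes "e > 0"
  shows "fps_nth ((1 + fps_X) ^ e * even_geom k) i > 0"
proof -
  have step: "fps_nth ((1 + fps_X) * f) i = fps_nth f i + (if i = 0 then 0 else fps_nth f (i - 1))"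
    for f :: "real fps" and i
    by (simp add: distrib_right)
  have "fps_nth ((1 + fps_X) ^ Suc e * even_geom k) i > 0" for e i
  proof (induction e arbitrary: i)
    case 0
    show ?case unfolding One_nat_def[symmetric] power_one_right step by (auto simp: even_geom_nth)
  next
    case (Suc e)
    have "(1 + fps_X) ^ Suc (Suc e) * even_geom k = (1 + fps_X) * ((1 + fps_X) ^ Suc e * even_geom k)"
      by (simp only: power_Suc mult.assoc)
    then show ?case using Suc[of i] Suc[of "i - 1"] by (simp only: step) auto
  qed
  then show ?thesis using assms by (cases e) simp_all
qed

section \<open>Coefficients for length \<open>24 * \<mu>\<close> and for the residues 16, 18 and
  20\<close>

lemma choose_four_fifths:
  assumes "\<mu> > 0"
  shows "(5 * \<mu>) choose (4 * \<mu>) = 5 * ((5 * \<mu> - 1) choose (\<mu> - 1))"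
proof -
  have "\<mu> * ((5 * \<mu>) choose \<mu>) = \<mu> * (5 * ((5 * \<mu> - 1) choose (\<mu> - 1)))"
    using times_binomial_minus1_eq[OF assms, of "5 * \<mu>"] by (simp only: mult_ac)
  moreover have "(5 * \<mu>) choose (4 * \<mu>) = (5 * \<mu>) choose \<mu>"
    using binomial_symmetric[of \<mu> "5 * \<mu>"] by simp
  ultimately show ?thesis using assms by (simp only: mult_cancel1) simp
qed

text \<open>The middle term of \<open>(1 + X)^2\<close> meets an odd coefficient. The outer two give
  \<open>(5 * \<mu>) choose (4 * \<mu>)\<close> and
  \<open>(5 * \<mu> - 1) choose (4 * \<mu>)\<close>, which are five copies and one copy of the
  binomial on the right.\<close>

lemma square_mult_even_geom_nth:
  assumes "\<mu> > 0"
  shows "fps_nth ((1 + fps_X) ^ 2 * even_geom (4 * \<mu>)) (2 * \<mu>) =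
         6 * of_nat ((5 * \<mu> - 1) choose (\<mu> - 1))"
proof -
  have "(1 + fps_X) ^ 2 * even_geom (4 * \<mu>) =
        even_geom (4 * \<mu>) + 2 * (fps_X * even_geom (4 * \<mu>)) + fps_X ^ 2 * even_geom (4 * \<mu>)"
    by (simp add: power2_eq_square algebra_simps)
  moreover have "4 * \<mu> + (2 * \<mu> - 2) div 2 = 5 * \<mu> - 1" "4 * \<mu> + 2 * \<mu> div 2 = 5 * \<mu>"
    "odd (2 * \<mu> - 1)" "even (2 * \<mu> - 2)"
    using assms by auto
  moreover have "(5 * \<mu> - 1) choose (4 * \<mu>) = (5 * \<mu> - 1) choose (\<mu> - 1)"
    using binomial_symmetric[of "\<mu> - 1" "5 * \<mu> - 1"] assms by simp
  ultimately show ?thesis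
    using assms choose_four_fifths[OF assms]
    by (simp add: fps_X_power_mult_nth even_geom_nth fps_numeral_nth numeral_fps_const)
qed

text \<open>Only even shifts of \<open>G\<close> contribute. The unshifted one is exactly
  \<open>5 * C m\<close>, the shift by 2 is \<open>C m\<close>, and later ones lie between
  \<open>0\<close> and \<open>C m\<close>. As \<open>X^2\<close> has coefficient \<open>-10\<close>,
  \<open>-14\<close> or \<open>-17\<close>, it outweighs the positive contributions, which total at
  most \<open>6 * C m\<close>.\<close>

lemma jacobian_mult_even_geom_nth_neg:
  assumes "e \<in> {2, 3, 4}"
  shows "fps_nth ((1 - 6 * fps_X + fps_X ^ 2) * ((1 + fps_X) ^ e * even_geom (4 * m + 4))) (2 * m + 2) < 0"
proof -
  define G where "G = even_geom (4 * m + 4)"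
  define C :: "nat \<Rightarrow> real" where "C i = of_nat ((4 * m + 4 + i) choose (4 * m + 4))" for i
  have C1: "C (m + 1) = 5 * C m"
  proof -
    have "(5 * (m + 1) - 1) choose (m + 1 - 1) = (4 * m + 4 + m) choose (4 * m + 4)"
      using binomial_symmetric[of m "5 * m + 4"] by (simp add: add_ac)
    then show ?thesis
      using choose_four_fifths[of "m + 1"] by (simp add: C_def add_ac)
  qed
  have Cmono: "C i \<le> C j" if "i \<le> j" for i j
    using that by (auto simp: C_def intro!: binomial_right_mono)
  have Cpos: "C i > 0" for i
    by (simp add: C_def)
  have G: "fps_nth G (2 * i) = C i" "fps_nth G (Suc (2 * i)) = 0" for i
    by (simp_all add: G_def even_geom_nth C_def)
  define g where "g i = fps_nth (fps_X ^ i * G) (2 * m + 2)" for i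
  have g: "g i = (if 2 * m + 2 < i then 0 else fps_nth G (2 * m + 2 - i))" for i
    by (simp add: g_def fps_X_power_mult_nth)
  have odd: "g i = 0" if "odd i" for i
  proof (cases "2 * m + 2 < i")
    case False
    then have "odd (2 * m + 2 - i)" using that by auto
    then show ?thesis by (simp add: g G_def even_geom_nth False)
  qed (simp add: g)
  have g02: "g 0 = 5 * C m" "g 2 = C m"
    using G(1)[of "m + 1"] G(1)[of m] C1 by (simp_all add: g)
  have le: "0 \<le> g (2 * i + 2)" "g (2 * i + 2) \<le> C m" for i
  proof -
    have "0 \<le> g (2 * i + 2) \<and> g (2 * i + 2) \<le> C m"
    proof (cases "i \<le> m")
      case True
      then have "g (2 * i + 2) = C (m - i)"
        using G(1)[of "m - i"] by (simp add: g diff_mult_distrib2)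
      then show ?thesis using Cmono[of "m - i" m] Cpos[of "m - i"] by simp
    qed (use Cpos[of m] in \<open>simp add: g\<close>)
    then show "0 \<le> g (2 * i + 2)" "g (2 * i + 2) \<le> C m" by auto
  qed
  have g46: "0 \<le> g 4" "g 4 \<le> C m" "0 \<le> g 6" "g 6 \<le> C m"
    using le[of 1] le[of 2] by simp_all
  have g135: "g 1 = 0" "g 3 = 0" "g 5 = 0"
    using odd by auto
  let ?f = "fps_nth ((1 - 6 * fps_X + fps_X ^ 2) * ((1 + fps_X) ^ e * G)) (2 * m + 2)"
  have num: "fps_nth (numeral k * f) i = numeral k * fps_nth f i" for k i and f :: "real fps"
    by (simp add: numeral_fps_const)
  consider "e = 2" | "e = 3" | "e = 4" using assms by auto
  then have "?f < 0"
  proof cases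
    case 1
    have "(1 - 6 * fps_X + fps_X ^ 2) * ((1 + fps_X) ^ e * G) =
      fps_X ^ 0 * G - 4 * (fps_X ^ 1 * G) - 10 * (fps_X ^ 2 * G) - 4 * (fps_X ^ 3 * G) + fps_X ^ 4 * G"
      unfolding 1 by algebra
    then have "?f = g 0 - 4 * g 1 - 10 * g 2 - 4 * g 3 + g 4"
      by (simp only: g_def fps_sub_nth fps_add_nth num)
    then show ?thesis using g02 g46 g135 Cpos[of m] by simp
  next
    case 2
    have "(1 - 6 * fps_X + fps_X ^ 2) * ((1 + fps_X) ^ e * G) =
      fps_X ^ 0 * G - 3 * (fps_X ^ 1 * G) - 14 * (fps_X ^ 2 * G) - 14 * (fps_X ^ 3 * G)
      - 3 * (fps_X ^ 4 * G) + fps_X ^ 5 * G"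
      unfolding 2 by algebra
    then have "?f = g 0 - 3 * g 1 - 14 * g 2 - 14 * g 3 - 3 * g 4 + g 5"
      by (simp only: g_def fps_sub_nth fps_add_nth num)
    then show ?thesis using g02 g46 g135 Cpos[of m] by simp
  next
    case 3
    have "(1 - 6 * fps_X + fps_X ^ 2) * ((1 + fps_X) ^ e * G) =
      fps_X ^ 0 * G - 2 * (fps_X ^ 1 * G) - 17 * (fps_X ^ 2 * G) - 28 * (fps_X ^ 3 * G)
      - 17 * (fps_X ^ 4 * G) - 2 * (fps_X ^ 5 * G) + fps_X ^ 6 * G"
      unfolding 3 by algebra
    then have "?f = g 0 - 2 * g 1 - 17 * g 2 - 28 * g 3 - 17 * g 4 - 2 * g 5 + g 6"
      by (simp only: g_def fps_sub_nth fps_add_nth num)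
    then show ?thesis using g02 g46 g135 Cpos[of m] by simp
  qed
  then show ?thesis by (simp add: G_def)
qed

subsection \<open>Expansion of the weight enumerators\<close>

text \<open>The factor \<open>(P * Q) ^ (M - 4 * s u)\<close> homogenises the cone expansions, so
  all \<open>u\<close> share one basis and their natural coefficients simply add. The vanishing
  clause is kept for the doubly-even case.\<close>

lemma symmetric_cone_sum:
  fixes s :: "'u \<Rightarrow> nat"
  assumes cone: "\<And>s. symmetric_cone s (f s)" and s: "\<And>u. u \<in> U \<Longrightarrow> 4 * s u \<le> M"
  obtains E :: "nat \<Rightarrow> nat" where
    "\<And>j. \<forall>u\<in>U. s u < j \<Longrightarrow> E j = 0"
    "\<And>P Q. (\<Sum>u\<in>U. (P * Q) ^ (M - 4 * s u) * f (s u) (P ^ 4) (Q ^ 4)) =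
       (\<Sum>j\<le>M div 4. of_nat (E j) * ((P * Q) ^ (M - 4 * j) * ((P ^ 4 - Q ^ 4) ^ 2) ^ j))"
proof -
  obtain c :: "nat \<Rightarrow> nat \<Rightarrow> nat" where
    c: "\<And>s A B. f s A B = (\<Sum>j\<le>s. of_nat (c s j) * (A * B) ^ (s - j) * ((A - B) ^ 2) ^ j)"
    using cone unfolding symmetric_cone_def by metis
  \<comment> \<open>Padding with zeros lets every inner sum run up to the common bound
    \<open>M div 4\<close>.\<close>
  define c' where "c' s j = (if j \<le> s then c s j else 0)" for s j
  have summand: "(P * Q) ^ (M - 4 * s u) * f (s u) (P ^ 4) (Q ^ 4) =
     (\<Sum>j\<le>M div 4. of_nat (c' (s u) j) * ((P * Q) ^ (M - 4 * j) * ((P ^ 4 - Q ^ 4) ^ 2) ^ j))"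
    if "u \<in> U" for u P Q
  proof -
    have "(P * Q) ^ (M - 4 * s u) * f (s u) (P ^ 4) (Q ^ 4) =
      (\<Sum>j\<le>s u. of_nat (c' (s u) j) * ((P * Q) ^ (M - 4 * j) * ((P ^ 4 - Q ^ 4) ^ 2) ^ j))"
      unfolding c sum_distrib_left
    proof (rule sum.cong[OF refl])
      fix j assume j: "j \<in> {..s u}"
      have "M - 4 * j = (M - 4 * s u) + 4 * (s u - j)" using s[OF that] j by auto
      then have "(P * Q) ^ (M - 4 * j) = (P * Q) ^ (M - 4 * s u) * (P ^ 4 * Q ^ 4) ^ (s u - j)"
        by (simp only: power_add power_mult power_mult_distrib)
      then show "(P * Q) ^ (M - 4 * s u) *
          (of_nat (c (s u) j) * (P ^ 4 * Q ^ 4) ^ (s u - j) * ((P ^ 4 - Q ^ 4)\<^sup>2) ^ j) =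
          of_nat (c' (s u) j) * ((P * Q) ^ (M - 4 * j) * ((P ^ 4 - Q ^ 4)\<^sup>2) ^ j)"
        using j by (simp add: c'_def mult_ac)
    qed
    also have "\<dots> = (\<Sum>j\<le>M div 4. of_nat (c' (s u) j) * ((P * Q) ^ (M - 4 * j) * ((P ^ 4 - Q ^ 4) ^ 2) ^ j))"
      using s[OF that] by (intro sum.mono_neutral_left) (auto simp: c'_def)
    finally show ?thesis .
  qed
  show ?thesis
  proof (rule that[of "\<lambda>j. \<Sum>u\<in>U. c' (s u) j"])
    show "(\<Sum>u\<in>U. c' (s u) j) = 0" if "\<forall>u\<in>U. s u < j" for j
      using that by (intro sum.neutral) (auto simp: c'_def)
    show "(\<Sum>u\<in>U. (P * Q) ^ (M - 4 * s u) * f (s u) (P ^ 4) (Q ^ 4)) =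
       (\<Sum>j\<le>M div 4. of_nat (\<Sum>u\<in>U. c' (s u) j) * ((P * Q) ^ (M - 4 * j) * ((P ^ 4 - Q ^ 4) ^ 2) ^ j))" for P Q
    proof -
      have "(\<Sum>u\<in>U. (P * Q) ^ (M - 4 * s u) * f (s u) (P ^ 4) (Q ^ 4)) =
        (\<Sum>u\<in>U. \<Sum>j\<le>M div 4. of_nat (c' (s u) j) * ((P * Q) ^ (M - 4 * j) * ((P ^ 4 - Q ^ 4) ^ 2) ^ j))"
        by (rule sum.cong[OF refl summand])
      also have "\<dots> = (\<Sum>j\<le>M div 4. of_nat (\<Sum>u\<in>U. c' (s u) j) * ((P * Q) ^ (M - 4 * j) * ((P ^ 4 - Q ^ 4) ^ 2) ^ j))"
        by (subst sum.swap) (simp add: sum_distrib_right)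
      finally show ?thesis .
    qed
  qed
qed

context semi_self_dual_half_length
begin

text \<open>Complementation carries the heavy half of the shadow to the light half. A vector of
  weight \<open>N\<close> has its complement in the same range, hence contributes \<open>h N\<close>
  only once.\<close>

lemma sum_shadow_fold:
  fixes h :: "nat \<Rightarrow> complex"
  assumes p: "\<And>w. w \<le> n \<Longrightarrow> p (n - w) = p w"
  shows "(\<Sum>u | u \<in> shadow n D \<and> p (wt u). h (wt u)) =
         (\<Sum>u | u \<in> shadow n D \<and> p (wt u) \<and> wt u \<le> N. if wt u = N then h N else h (wt u) + h (n - wt u))"
proof -
  let ?S = "shadow n D"
  have le: "wt u \<le> n" if "u \<in> ?S" for u
    using that shadow_subset wt_le by auto
  have "(\<Sum>u | u \<in> ?S \<and> (p (wt u) \<and> wt u > N). h (wt u)) =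
        (\<Sum>u | u \<in> ?S \<and> (p (n - wt u) \<and> n - wt u > N). h (n - wt u))"
    using sum_shadow_reflect[where p = "\<lambda>w. p w \<and> w > N"] .
  also have "{u \<in> ?S. p (n - wt u) \<and> n - wt u > N} = {u \<in> ?S. p (wt u) \<and> wt u \<le> N} - {u. wt u = N}"
    using p le n_eq by fastforce
  also have "(\<Sum>u\<in>{u \<in> ?S. p (wt u) \<and> wt u \<le> N} - {u. wt u = N}. h (n - wt u)) =
    (\<Sum>u | u \<in> ?S \<and> p (wt u) \<and> wt u \<le> N. if wt u = N then 0 else h (n - wt u))"
    by (rule sum.mono_neutral_cong_left) (auto simp: finite_shadow)
  finally have gt: "(\<Sum>u | u \<in> ?S \<and> p (wt u) \<and> wt u > N. h (wt u)) =
    (\<Sum>u | u \<in> ?S \<and> p (wt u) \<and> wt u \<le> N. if wt u = N then 0 else h (n - wt u))" .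
  have "{u \<in> ?S. p (wt u)} = {u \<in> ?S. p (wt u) \<and> wt u \<le> N} \<union> {u \<in> ?S. p (wt u) \<and> wt u > N}"
    by auto
  then have "(\<Sum>u | u \<in> ?S \<and> p (wt u). h (wt u)) =
    (\<Sum>u | u \<in> ?S \<and> p (wt u) \<and> wt u \<le> N. h (wt u)) + (\<Sum>u | u \<in> ?S \<and> p (wt u) \<and> wt u > N. h (wt u))"
    using finite_shadow by (simp only:) (intro sum.union_disjoint; auto)
  then show ?thesis
    unfolding gt sum.distrib[symmetric] by (auto intro!: sum.cong)
qed

lemma weight_enum_D_shadow:
  "2 * 2 ^ N * weight_enum n D 1 y = (\<Sum>u\<in>shadow n D. (1 - \<i> * y) ^ (n - wt u) * (1 + \<i> * y) ^ wt u)"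
  using weight_enum_D[of 1 y] by (simp add: weight_enum_def)

lemma diff_weight_enum:
  "2 ^ N * (2 * weight_enum n D 1 y - weight_enum n (dual n D) 1 y) =
   2 * (\<Sum>u | u \<in> shadow n D \<and> wt u mod 4 \<noteq> N mod 4. (1 - \<i> * y) ^ (n - wt u) * (1 + \<i> * y) ^ wt u)"
proof -
  have "2 ^ N * (2 * weight_enum n D 1 y - weight_enum n (dual n D) 1 y) =
    (\<Sum>u\<in>shadow n D. if wt u mod 4 \<noteq> N mod 4 then 2 * ((1 - \<i> * y) ^ (n - wt u) * (1 + \<i> * y) ^ wt u) else 0)"
    unfolding right_diff_distrib weight_enum_dual_signed
      mult.assoc[symmetric] mult.commute[of "2 ^ N" 2] weight_enum_D_shadow sum_subtractf[symmetric]
    by (intro sum.cong) auto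
  also have "\<dots> = 2 * (\<Sum>u | u \<in> shadow n D \<and> wt u mod 4 \<noteq> N mod 4. (1 - \<i> * y) ^ (n - wt u) * (1 + \<i> * y) ^ wt u)"
    unfolding sum_distrib_left using finite_shadow by (intro sum.mono_neutral_cong_right) auto
  finally show ?thesis .
qed

lemma sum_weight_enum:
  "2 ^ N * (2 * weight_enum n D 1 y + weight_enum n (dual n D) 1 y) =
   2 * (\<Sum>u | u \<in> shadow n D \<and> wt u mod 4 = N mod 4. (1 - \<i> * y) ^ (n - wt u) * (1 + \<i> * y) ^ wt u)"
proof -
  have "2 ^ N * (2 * weight_enum n D 1 y + weight_enum n (dual n D) 1 y) =
    (\<Sum>u\<in>shadow n D. if wt u mod 4 = N mod 4 then 2 * ((1 - \<i> * y) ^ (n - wt u) * (1 + \<i> * y) ^ wt u) else 0)"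
    unfolding distrib_left weight_enum_dual_signed
      mult.assoc[symmetric] mult.commute[of "2 ^ N" 2] weight_enum_D_shadow sum.distrib[symmetric]
    by (intro sum.cong) auto
  also have "\<dots> = 2 * (\<Sum>u | u \<in> shadow n D \<and> wt u mod 4 = N mod 4. (1 - \<i> * y) ^ (n - wt u) * (1 + \<i> * y) ^ wt u)"
    unfolding sum_distrib_left using finite_shadow by (intro sum.mono_neutral_cong_right) auto
  finally show ?thesis .
qed

lemma mod4_iff_reflect: "w \<le> n \<Longrightarrow> (n - w) mod 4 = N mod 4 \<longleftrightarrow> w mod 4 = N mod 4"
  using mod4_reflect[of w "n - w" N] n_eq by simp

text \<open>Here \<open>N - wt u\<close> is twice an odd number, so complementary weights differ by
  \<open>4 * (2 * s + 1)\<close> and each pair gives an odd-power sum in \<open>P ^ 4\<close> and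
  \<open>Q ^ 4\<close>. This is the origin of the common factor
  \<open>P ^ 4 + Q ^ 4\<close>.\<close>

lemma diff_expansion:
  obtains E :: "nat \<Rightarrow> nat" where
    "\<And>j. \<forall>u\<in>shadow n D. wt u mod 4 \<noteq> N mod 4 \<longrightarrow> (N - 2 - wt u) div 4 < j \<Longrightarrow> E j = 0"
    "\<And>y. 2 ^ N * (2 * weight_enum n D 1 y - weight_enum n (dual n D) 1 y) =
       2 * (((1 + \<i> * y) ^ 4 + (1 - \<i> * y) ^ 4) * (\<Sum>j\<le>(N - 2) div 4. of_nat (E j) *
         (((1 + \<i> * y) * (1 - \<i> * y)) ^ (N - 2 - 4 * j) * (((1 + \<i> * y) ^ 4 - (1 - \<i> * y) ^ 4) ^ 2) ^ j)))"
proof -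
  let ?U = "{u \<in> shadow n D. wt u mod 4 \<noteq> N mod 4 \<and> wt u \<le> N}"
  define s where "s u = (N - 2 - wt u) div 4" for u :: "nat \<Rightarrow> bit"
  have wt: "wt u = N - 2 - 4 * s u \<and> 4 * s u \<le> N - 2 \<and> n - wt u = wt u + 4 * (2 * s u + 1) \<and> wt u \<noteq> N"
    if "u \<in> ?U" for u
  proof -
    have "wt u mod 4 \<noteq> N mod 4" "wt u \<le> N" "even (wt u + N)"
      using that shadow_wt_parity by auto
    then have "even (N - wt u)" by auto
    then obtain d where d: "N - wt u = 2 * d" by blast
    then have N: "N = wt u + 2 * d" using \<open>wt u \<le> N\<close> by simp
    then have "odd d" using even_iff_mod4[of d "wt u"] \<open>wt u mod 4 \<noteq> N mod 4\<close> by metis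
    then obtain t where "d = 2 * t + 1" by (elim oddE)
    then have "N = wt u + 4 * t + 2" using N by simp
    then show ?thesis by (simp add: s_def n_eq)
  qed
  obtain E :: "nat \<Rightarrow> nat" where
    E0: "\<And>j. \<forall>u\<in>?U. s u < j \<Longrightarrow> E j = 0" and
    E: "\<And>P Q. (\<Sum>u\<in>?U. (P * Q) ^ (N - 2 - 4 * s u) * odd_power_quotient (s u) (P ^ 4) (Q ^ 4)) =
       (\<Sum>j\<le>(N - 2) div 4. of_nat (E j) * ((P * Q) ^ (N - 2 - 4 * j) * ((P ^ 4 - Q ^ 4) ^ 2) ^ j))"
  proof (rule symmetric_cone_sum[of odd_power_quotient ?U s "N - 2", OF symmetric_cone_odd_power_quotient])
    show "4 * s u \<le> N - 2" if "u \<in> ?U" for u using wt[OF that] by blast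
  qed (rule that)
  show ?thesis
  proof (rule that[of E])
    show "E j = 0" if "\<forall>u\<in>shadow n D. wt u mod 4 \<noteq> N mod 4 \<longrightarrow> (N - 2 - wt u) div 4 < j" for j
      using that by (intro E0) (auto simp: s_def)
    fix y :: complex
    define P Q where "P = 1 + \<i> * y" and "Q = 1 - \<i> * y"
    have "(\<Sum>u | u \<in> shadow n D \<and> wt u mod 4 \<noteq> N mod 4. Q ^ (n - wt u) * P ^ wt u) =
      (\<Sum>u\<in>?U. if wt u = N then Q ^ (n - N) * P ^ N else Q ^ (n - wt u) * P ^ wt u + Q ^ (n - (n - wt u)) * P ^ (n - wt u))"
      using sum_shadow_fold[where p = "\<lambda>w. w mod 4 \<noteq> N mod 4" and h = "\<lambda>w. Q ^ (n - w) * P ^ w"]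
        mod4_iff_reflect by simp
    also have "\<dots> = (\<Sum>u\<in>?U. (P ^ 4 + Q ^ 4) * ((P * Q) ^ (N - 2 - 4 * s u) * odd_power_quotient (s u) (P ^ 4) (Q ^ 4)))"
    proof (rule sum.cong[OF refl])
      fix u assume u: "u \<in> ?U"
      have w: "n - wt u = wt u + 4 * (2 * s u + 1)" "wt u \<noteq> N" "N - 2 - 4 * s u = wt u" "n - (n - wt u) = wt u"
        using wt[OF u] n_eq u by auto
      have "Q ^ (n - wt u) * P ^ wt u + Q ^ (n - (n - wt u)) * P ^ (n - wt u) =
            (P * Q) ^ wt u * ((P ^ 4) ^ (2 * s u + 1) + (Q ^ 4) ^ (2 * s u + 1))"
        unfolding w(4) unfolding w(1) power_add[of _ "wt u"] power_mult[of _ 4] power_mult_distrib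
        by (simp only: distrib_left mult_ac add_ac)
      then show "(if wt u = N then Q ^ (n - N) * P ^ N else Q ^ (n - wt u) * P ^ wt u + Q ^ (n - (n - wt u)) * P ^ (n - wt u)) =
        (P ^ 4 + Q ^ 4) * ((P * Q) ^ (N - 2 - 4 * s u) * odd_power_quotient (s u) (P ^ 4) (Q ^ 4))"
        unfolding w(3) odd_power_quotient using w(2) by (simp only: if_False mult_ac)
    qed
    also have "\<dots> = (P ^ 4 + Q ^ 4) * (\<Sum>j\<le>(N - 2) div 4. of_nat (E j) * ((P * Q) ^ (N - 2 - 4 * j) * ((P ^ 4 - Q ^ 4) ^ 2) ^ j))"
      unfolding sum_distrib_left[symmetric] E ..
    finally show "2 ^ N * (2 * weight_enum n D 1 y - weight_enum n (dual n D) 1 y) =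
       2 * (((1 + \<i> * y) ^ 4 + (1 - \<i> * y) ^ 4) * (\<Sum>j\<le>(N - 2) div 4. of_nat (E j) *
         (((1 + \<i> * y) * (1 - \<i> * y)) ^ (N - 2 - 4 * j) * (((1 + \<i> * y) ^ 4 - (1 - \<i> * y) ^ 4) ^ 2) ^ j)))"
      unfolding diff_weight_enum P_def Q_def by (rule arg_cong)
  qed
qed

text \<open>Complementary weights now differ by a multiple of 8, so pairs give even-power sums in
  \<open>P ^ 4\<close> and \<open>Q ^ 4\<close>, and no common factor is split off.\<close>

lemma sum_expansion:
  obtains E :: "nat \<Rightarrow> nat" where
    "\<And>y. 2 ^ N * (2 * weight_enum n D 1 y + weight_enum n (dual n D) 1 y) =
       2 * (\<Sum>j\<le>N div 4. of_nat (E j) *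
         (((1 + \<i> * y) * (1 - \<i> * y)) ^ (N - 4 * j) * (((1 + \<i> * y) ^ 4 - (1 - \<i> * y) ^ 4) ^ 2) ^ j))"
proof -
  let ?U = "{u \<in> shadow n D. wt u mod 4 = N mod 4 \<and> wt u \<le> N}"
  define s where "s u = (N - wt u) div 4" for u :: "nat \<Rightarrow> bit"
  have wt: "wt u = N - 4 * s u \<and> 4 * s u \<le> N \<and> n - wt u = wt u + 4 * (2 * s u)" if "u \<in> ?U" for u
  proof -
    have u: "wt u mod 4 = N mod 4" "wt u \<le> N"
      using that by auto
    then have "4 dvd N - wt u" using mod_eq_dvd_iff_nat[of "wt u" N 4] by auto
    then obtain t where "N - wt u = 4 * t" by blast
    then have "N = wt u + 4 * t" using u(2) by simp
    then show ?thesis by (simp add: s_def n_eq)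
  qed
  \<comment> \<open>Vectors of weight \<open>N\<close> are paired among themselves, so they count once, not twice.\<close>
  define f where "f s A B = (if s = 0 then 1 else A ^ (2 * s) + B ^ (2 * s))" for s and A B :: complex
  have cone: "symmetric_cone s (f s)" for s
    unfolding f_def using symmetric_cone_even_powers[of s] symmetric_cone_of_nat[of 1]
    by (cases "s = 0") simp_all
  obtain E :: "nat \<Rightarrow> nat" where
    E: "\<And>P Q. (\<Sum>u\<in>?U. (P * Q) ^ (N - 4 * s u) * f (s u) (P ^ 4) (Q ^ 4)) =
       (\<Sum>j\<le>N div 4. of_nat (E j) * ((P * Q) ^ (N - 4 * j) * ((P ^ 4 - Q ^ 4) ^ 2) ^ j))"
  proof (rule symmetric_cone_sum[of f ?U s N, OF cone])
    show "4 * s u \<le> N" if "u \<in> ?U" for u using wt[OF that] by blast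
  qed (rule that)
  show ?thesis
  proof (rule that[of E])
    fix y :: complex
    define P Q where "P = 1 + \<i> * y" and "Q = 1 - \<i> * y"
    have "(\<Sum>u | u \<in> shadow n D \<and> wt u mod 4 = N mod 4. Q ^ (n - wt u) * P ^ wt u) =
      (\<Sum>u\<in>?U. if wt u = N then Q ^ (n - N) * P ^ N else Q ^ (n - wt u) * P ^ wt u + Q ^ (n - (n - wt u)) * P ^ (n - wt u))"
      using sum_shadow_fold[where p = "\<lambda>w. w mod 4 = N mod 4" and h = "\<lambda>w. Q ^ (n - w) * P ^ w"]
        mod4_iff_reflect by simp
    also have "\<dots> = (\<Sum>u\<in>?U. (P * Q) ^ (N - 4 * s u) * f (s u) (P ^ 4) (Q ^ 4))"
    proof (rule sum.cong[OF refl])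
      fix u assume u: "u \<in> ?U"
      have w: "n - wt u = wt u + 4 * (2 * s u)" "N - 4 * s u = wt u" "n - (n - wt u) = wt u" "wt u = N \<longleftrightarrow> s u = 0"
        using wt[OF u] n_eq u by auto
      have "Q ^ (n - wt u) * P ^ wt u + Q ^ (n - (n - wt u)) * P ^ (n - wt u) =
            (P * Q) ^ wt u * ((P ^ 4) ^ (2 * s u) + (Q ^ 4) ^ (2 * s u))"
        unfolding w(3) unfolding w(1) power_add[of _ "wt u"] power_mult[of _ 4] power_mult_distrib
        by (simp only: distrib_left mult_ac add_ac)
      moreover have "Q ^ (n - N) * P ^ N = (P * Q) ^ N"
        using n_eq by (simp add: power_mult_distrib mult_ac)
      ultimately show "(if wt u = N then Q ^ (n - N) * P ^ N else Q ^ (n - wt u) * P ^ wt u + Q ^ (n - (n - wt u)) * P ^ (n - wt u)) =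
        (P * Q) ^ (N - 4 * s u) * f (s u) (P ^ 4) (Q ^ 4)"
        unfolding w(2) f_def using w(4) by (cases "wt u = N") auto
    qed
    also note E
    finally show "2 ^ N * (2 * weight_enum n D 1 y + weight_enum n (dual n D) 1 y) =
       2 * (\<Sum>j\<le>N div 4. of_nat (E j) *
         (((1 + \<i> * y) * (1 - \<i> * y)) ^ (N - 4 * j) * (((1 + \<i> * y) ^ 4 - (1 - \<i> * y) ^ 4) ^ 2) ^ j))"
      unfolding sum_weight_enum P_def Q_def by (rule arg_cong)
  qed
qed

end

section \<open>Passage to real polynomials and power series in \<open>Y = y\<^sup>2\<close>\<close>

definition half_weight_poly :: "(nat \<Rightarrow> bit) set \<Rightarrow> real poly" where
  "half_weight_poly C = (\<Sum>v\<in>C. monom 1 (wt v div 2))"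

lemma weight_enum_eq_half_weight_poly:
  assumes "\<And>v. v \<in> C \<Longrightarrow> even (wt v)"
  shows "weight_enum n C 1 (of_real y) = of_real (poly (half_weight_poly C) (y ^ 2))"
proof -
  have "(of_real y :: complex) ^ wt v = of_real ((y ^ 2) ^ (wt v div 2))" if "v \<in> C" for v
    using assms[OF that] by (simp add: power_mult[symmetric])
  then show ?thesis
    by (simp add: weight_enum_def half_weight_poly_def poly_sum poly_monom)
qed

text \<open>Real arguments \<open>y\<close> test the identities only at nonnegative points, but
  these are infinitely many.\<close>

lemma poly_eq_if_eq_on_squares:
  fixes p q :: "real poly"
  assumes "\<And>y. poly p (y ^ 2) = poly q (y ^ 2)"
  shows "p = q"
proof (rule ccontr)
  assume "p \<noteq> q"
  then have "finite {x. poly (p - q) x = 0}" by (intro poly_roots_finite) simp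
  moreover have "{0..} \<subseteq> {x. poly (p - q) x = 0}"
  proof
    fix x :: real assume "x \<in> {0..}"
    then show "x \<in> {x. poly (p - q) x = 0}" using assms[of "sqrt x"] by simp
  qed
  ultimately show False using infinite_Ici finite_subset by blast
qed

lemma gaussian_fourth_powers:
  fixes y :: complex
  shows "(1 + \<i> * y) * (1 - \<i> * y) = 1 + y ^ 2"
    and "(1 + \<i> * y) ^ 4 + (1 - \<i> * y) ^ 4 = 2 * (1 - 6 * y ^ 2 + (y ^ 2) ^ 2)"
    and "((1 + \<i> * y) ^ 4 - (1 - \<i> * y) ^ 4) ^ 2 = -64 * (y ^ 2 * (1 - y ^ 2) ^ 2)"
proof -
  have i: "\<i> ^ 2 = -1" by simp
  show "(1 + \<i> * y) * (1 - \<i> * y) = 1 + y ^ 2"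
    using i by algebra
  show "(1 + \<i> * y) ^ 4 + (1 - \<i> * y) ^ 4 = 2 * (1 - 6 * y ^ 2 + (y ^ 2) ^ 2)"
    using i by algebra
  show "((1 + \<i> * y) ^ 4 - (1 - \<i> * y) ^ 4) ^ 2 = -64 * (y ^ 2 * (1 - y ^ 2) ^ 2)"
    using i by algebra
qed

text \<open>The zero word contributes the constant \<open>1\<close> and every other word a power
  above \<open>r\<close>, so up to degree \<open>r\<close> the enumerator acts as
  \<open>1\<close>.\<close>

lemma low_order_half_weight:
  assumes C: "finite C" "(\<lambda>_. 0) \<in> C"
    and big: "\<And>v. v \<in> C \<Longrightarrow> v \<noteq> (\<lambda>_. 0) \<Longrightarrow> r < wt v div 2"
  shows "fps_nth (fps_of_poly (half_weight_poly C) * f) r = fps_nth f r"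
proof -
  have "fps_of_poly (half_weight_poly C) * f = (\<Sum>v\<in>C. fps_X ^ (wt v div 2) * f)"
    by (simp add: half_weight_poly_def fps_of_poly_sum fps_of_poly_monom' sum_distrib_right)
  then have "fps_nth (fps_of_poly (half_weight_poly C) * f) r =
      (\<Sum>v\<in>C. if r < wt v div 2 then 0 else fps_nth f (r - wt v div 2))"
    by (simp add: fps_sum_nth fps_X_power_mult_nth)
  also have "\<dots> = (\<Sum>v\<in>C. if v = (\<lambda>_. 0) then fps_nth f r else 0)"
    using big by (intro sum.cong) (auto simp: wt_def)
  also have "\<dots> = fps_nth f r" using C by simp
  finally show ?thesis .
qed

context semi_self_dual_half_length
begin

lemma diff_expansion_fps:
  obtains E :: "nat \<Rightarrow> nat" where
    "\<And>j. \<forall>u\<in>shadow n D. wt u mod 4 \<noteq> N mod 4 \<longrightarrow> (N - 2 - wt u) div 4 < j \<Longrightarrow> E j = 0"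
    "fps_const (2 ^ N) * (2 * fps_of_poly (half_weight_poly D) - fps_of_poly (half_weight_poly (dual n D))) =
     (1 - 6 * fps_X + fps_X ^ 2) * (\<Sum>j\<le>(N - 2) div 4. fps_const (4 * (- 64) ^ j * of_nat (E j)) *
       (1 + fps_X) ^ (N - 2 - 4 * j) * (fps_X * (1 - fps_X) ^ 2) ^ j)"
proof -
  obtain E :: "nat \<Rightarrow> nat" where
    E0: "\<And>j. \<forall>u\<in>shadow n D. wt u mod 4 \<noteq> N mod 4 \<longrightarrow> (N - 2 - wt u) div 4 < j \<Longrightarrow> E j = 0"
    and E: "\<And>y. 2 ^ N * (2 * weight_enum n D 1 y - weight_enum n (dual n D) 1 y) =
       2 * (((1 + \<i> * y) ^ 4 + (1 - \<i> * y) ^ 4) * (\<Sum>j\<le>(N - 2) div 4. of_nat (E j) *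
         (((1 + \<i> * y) * (1 - \<i> * y)) ^ (N - 2 - 4 * j) * (((1 + \<i> * y) ^ 4 - (1 - \<i> * y) ^ 4) ^ 2) ^ j)))"
    by (rule diff_expansion) (rule that)
  \<comment> \<open>One factor \<open>2\<close> comes from the doubled half of the shadow, the other
    from \<open>P ^ 4 + Q ^ 4\<close>; the resulting \<open>4\<close> later forces a binomial
    coefficient to be even.\<close>
  have rearrange: "2 * (2 * x * (c * (a * (d * b)))) = x * (4 * d * c * a * b)" for x a b c d :: complex
    by simp
  have real: "2 ^ N * (2 * poly (half_weight_poly D) (y ^ 2) - poly (half_weight_poly (dual n D)) (y ^ 2)) =
    (1 - 6 * y ^ 2 + (y ^ 2) ^ 2) * (\<Sum>j\<le>(N - 2) div 4. (4 * (- 64) ^ j * of_nat (E j)) *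
       (1 + y ^ 2) ^ (N - 2 - 4 * j) * (y ^ 2 * (1 - y ^ 2) ^ 2) ^ j)" (is "?L = ?R") for y :: real
  proof -
    have "complex_of_real ?L = 2 ^ N * (2 * weight_enum n D 1 (of_real y) - weight_enum n (dual n D) 1 (of_real y))"
      using D_subset_dual dual_wt_even by (subst (1 2) weight_enum_eq_half_weight_poly) auto
    also have "\<dots> = (1 - 6 * of_real y ^ 2 + (of_real y ^ 2) ^ 2) * (\<Sum>j\<le>(N - 2) div 4. (4 * (- 64) ^ j * of_nat (E j)) *
       (1 + of_real y ^ 2) ^ (N - 2 - 4 * j) * (of_real y ^ 2 * (1 - of_real y ^ 2) ^ 2) ^ j)"
      unfolding E gaussian_fourth_powers power_mult_distrib[of "- 64"] sum_distrib_left
      by (intro sum.cong refl) (rule rearrange)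
    also have "\<dots> = complex_of_real ?R"
      by simp
    finally show ?thesis by (simp only: of_real_eq_iff)
  qed
  define X :: "real poly" where "X = [:0, 1:]"
  have "[:2 ^ N:] * (2 * half_weight_poly D - half_weight_poly (dual n D)) =
     (1 - 6 * X + X ^ 2) * (\<Sum>j\<le>(N - 2) div 4. [:4 * (- 64) ^ j * of_nat (E j):] *
       (1 + X) ^ (N - 2 - 4 * j) * (X * (1 - X) ^ 2) ^ j)"
    using real by (intro poly_eq_if_eq_on_squares) (simp add: X_def poly_sum mult_ac)
  then have "fps_of_poly \<dots> = fps_of_poly ([:2 ^ N:] * (2 * half_weight_poly D - half_weight_poly (dual n D)))"
    by simp
  then have "fps_const (2 ^ N) * (2 * fps_of_poly (half_weight_poly D) - fps_of_poly (half_weight_poly (dual n D))) =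
     (1 - 6 * fps_X + fps_X ^ 2) * (\<Sum>j\<le>(N - 2) div 4. fps_const (4 * (- 64) ^ j * of_nat (E j)) *
       (1 + fps_X) ^ (N - 2 - 4 * j) * (fps_X * (1 - fps_X) ^ 2) ^ j)"
    by (simp only: X_def fps_of_poly_mult fps_of_poly_add fps_of_poly_diff fps_of_poly_sum
        fps_of_poly_power fps_of_poly_1 fps_of_poly_numeral fps_of_poly_fps_X fps_of_poly_const)
  with E0 show ?thesis by (rule that)
qed

lemma sum_expansion_fps:
  obtains E :: "nat \<Rightarrow> nat" where
    "fps_const (2 ^ N) * (2 * fps_of_poly (half_weight_poly D) + fps_of_poly (half_weight_poly (dual n D))) =
     (\<Sum>j\<le>N div 4. fps_const (2 * (- 64) ^ j * of_nat (E j)) *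
       (1 + fps_X) ^ (N - 4 * j) * (fps_X * (1 - fps_X) ^ 2) ^ j)"
proof -
  obtain E :: "nat \<Rightarrow> nat" where
    E: "\<And>y. 2 ^ N * (2 * weight_enum n D 1 y + weight_enum n (dual n D) 1 y) =
       2 * (\<Sum>j\<le>N div 4. of_nat (E j) *
         (((1 + \<i> * y) * (1 - \<i> * y)) ^ (N - 4 * j) * (((1 + \<i> * y) ^ 4 - (1 - \<i> * y) ^ 4) ^ 2) ^ j))"
    by (rule sum_expansion) (rule that)
  have real: "2 ^ N * (2 * poly (half_weight_poly D) (y ^ 2) + poly (half_weight_poly (dual n D)) (y ^ 2)) =
    (\<Sum>j\<le>N div 4. (2 * (- 64) ^ j * of_nat (E j)) *
       (1 + y ^ 2) ^ (N - 4 * j) * (y ^ 2 * (1 - y ^ 2) ^ 2) ^ j)" (is "?L = ?R") for y :: real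
  proof -
    have "complex_of_real ?L = 2 ^ N * (2 * weight_enum n D 1 (of_real y) + weight_enum n (dual n D) 1 (of_real y))"
      using D_subset_dual dual_wt_even by (subst (1 2) weight_enum_eq_half_weight_poly) auto
    also have "\<dots> = (\<Sum>j\<le>N div 4. (2 * (- 64) ^ j * of_nat (E j)) *
       (1 + of_real y ^ 2) ^ (N - 4 * j) * (of_real y ^ 2 * (1 - of_real y ^ 2) ^ 2) ^ j)"
      unfolding E gaussian_fourth_powers power_mult_distrib[of "- 64"] sum_distrib_left
      by (simp only: mult_ac)
    also have "\<dots> = complex_of_real ?R"
      by simp
    finally show ?thesis by (simp only: of_real_eq_iff)
  qed
  define X :: "real poly" where "X = [:0, 1:]"
  have "[:2 ^ N:] * (2 * half_weight_poly D + half_weight_poly (dual n D)) =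
     (\<Sum>j\<le>N div 4. [:2 * (- 64) ^ j * of_nat (E j):] *
       (1 + X) ^ (N - 4 * j) * (X * (1 - X) ^ 2) ^ j)"
    using real by (intro poly_eq_if_eq_on_squares) (simp add: X_def poly_sum mult_ac)
  then have "fps_of_poly \<dots> = fps_of_poly ([:2 ^ N:] * (2 * half_weight_poly D + half_weight_poly (dual n D)))"
    by simp
  then have "fps_const (2 ^ N) * (2 * fps_of_poly (half_weight_poly D) + fps_of_poly (half_weight_poly (dual n D))) =
     (\<Sum>j\<le>N div 4. fps_const (2 * (- 64) ^ j * of_nat (E j)) *
       (1 + fps_X) ^ (N - 4 * j) * (fps_X * (1 - fps_X) ^ 2) ^ j)"
    by (simp only: X_def fps_of_poly_mult fps_of_poly_add fps_of_poly_diff fps_of_poly_sum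
        fps_of_poly_power fps_of_poly_1 fps_of_poly_numeral fps_of_poly_fps_X fps_of_poly_const)
  then show ?thesis by (rule that)
qed

section \<open>Coefficient comparison when all nonzero dual words have weight above
  \<open>2 * r\<close>\<close>

context
  fixes r :: nat
  assumes big: "\<And>v. v \<in> dual n D \<Longrightarrow> v \<noteq> (\<lambda>_. 0) \<Longrightarrow> 2 * r < wt v"
begin

lemma low_order_nth:
  "fps_nth (fps_of_poly (half_weight_poly D) * f) r = fps_nth f r"
  "fps_nth (fps_of_poly (half_weight_poly (dual n D)) * f) r = fps_nth f r"
proof -
  have "r < wt v div 2" if "v \<in> dual n D" "v \<noteq> (\<lambda>_. 0)" for v
    using big[OF that] dual_wt_even[OF that(1)] by (auto elim!: evenE)
  then show "fps_nth (fps_of_poly (half_weight_poly D) * f) r = fps_nth f r"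
    "fps_nth (fps_of_poly (half_weight_poly (dual n D)) * f) r = fps_nth f r"
    using D_subset_dual zero_in finite_D finite_dual
    by (auto intro!: low_order_half_weight)
qed

text \<open>The left side of the expansion acts as \<open>2 - 1 = 1\<close> up to degree
  \<open>r\<close>, while the right side already carries the Jacobian factor, so
  \<open>lagrange_extract\<close> isolates its \<open>r\<close>-th coefficient. An \<open>r\<close>
  beyond the summation range is covered by \<open>E = 0\<close>.\<close>

lemma diff_coefficient:
  assumes e: "6 * r + 2 = e + N"
  obtains E :: nat where
    "2 ^ N * fps_nth ((1 + fps_X) ^ e * even_geom (2 * r)) r = 4 * (- 64) ^ r * of_nat E"
    "\<forall>u\<in>shadow n D. wt u mod 4 \<noteq> N mod 4 \<longrightarrow> (N - 2 - wt u) div 4 < r \<Longrightarrow> E = 0"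
proof -
  obtain E :: "nat \<Rightarrow> nat" where
    E0: "\<And>j. \<forall>u\<in>shadow n D. wt u mod 4 \<noteq> N mod 4 \<longrightarrow> (N - 2 - wt u) div 4 < j \<Longrightarrow> E j = 0"
    and E: "fps_const (2 ^ N) * (2 * fps_of_poly (half_weight_poly D) - fps_of_poly (half_weight_poly (dual n D))) =
     (1 - 6 * fps_X + fps_X ^ 2) * (\<Sum>j\<le>(N - 2) div 4. fps_const (4 * (- 64) ^ j * of_nat (E j)) *
       (1 + fps_X) ^ (N - 2 - 4 * j) * (fps_X * (1 - fps_X) ^ 2) ^ j)"
    by (rule diff_expansion_fps) (rule that)
  define T where "T = (1 + fps_X) ^ (4 * r) * inverse (1 + fps_X) ^ (N - 2 + 1) * inverse (1 - fps_X :: real fps) ^ (2 * r + 1)"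
  have T: "T = (1 + fps_X) ^ e * even_geom (2 * r)"
    unfolding T_def using e N_ge_2 by (intro power_ratio_eq_even_geom) auto
  have "2 ^ N * fps_nth T r =
      fps_nth (fps_const (2 ^ N) * (2 * (fps_of_poly (half_weight_poly D) * T) - fps_of_poly (half_weight_poly (dual n D)) * T)) r"
    by (simp add: low_order_nth numeral_fps_const)
  also have "fps_const (2 ^ N) * (2 * (fps_of_poly (half_weight_poly D) * T) - fps_of_poly (half_weight_poly (dual n D)) * T) =
      fps_const (2 ^ N) * (2 * fps_of_poly (half_weight_poly D) - fps_of_poly (half_weight_poly (dual n D))) * T"
    by (simp only: left_diff_distrib right_diff_distrib mult.assoc)
  also have "fps_nth \<dots> r = (if r \<le> (N - 2) div 4 then 4 * (- 64) ^ r * of_nat (E r) else 0)"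
    unfolding E T_def mult.assoc[symmetric]
    using lagrange_extract[of "(N - 2) div 4" "N - 2" "\<lambda>j. 4 * (- 64) ^ j * of_nat (E j)" r]
    by (simp only: mult.assoc[symmetric])
  finally have *: "2 ^ N * fps_nth T r = 4 * (- 64) ^ r * of_nat (if r \<le> (N - 2) div 4 then E r else 0)"
    by simp
  show ?thesis
    by (rule that[OF *[unfolded T]]) (simp add: E0)
qed

text \<open>This expansion has no Jacobian factor of its own, so both sides are multiplied by it.
  The constant \<open>3\<close> is \<open>2 + 1\<close>, from the zero words of \<open>D\<close> and
  of its dual.\<close>

lemma sum_coefficient:
  assumes e: "6 * r = e + N"
  obtains E :: nat where
    "3 * 2 ^ N * fps_nth ((1 - 6 * fps_X + fps_X ^ 2) * ((1 + fps_X) ^ e * even_geom (2 * r))) r =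
     2 * (- 64) ^ r * of_nat E"
proof -
  obtain E :: "nat \<Rightarrow> nat" where
    E: "fps_const (2 ^ N) * (2 * fps_of_poly (half_weight_poly D) + fps_of_poly (half_weight_poly (dual n D))) =
     (\<Sum>j\<le>N div 4. fps_const (2 * (- 64) ^ j * of_nat (E j)) *
       (1 + fps_X) ^ (N - 4 * j) * (fps_X * (1 - fps_X) ^ 2) ^ j)"
    by (rule sum_expansion_fps) (rule that)
  define T where "T = (1 + fps_X) ^ (4 * r) * inverse (1 + fps_X) ^ (N + 1) * inverse (1 - fps_X :: real fps) ^ (2 * r + 1)"
  have T: "T = (1 + fps_X) ^ e * even_geom (2 * r)"
    unfolding T_def using e by (intro power_ratio_eq_even_geom) auto
  define q :: "real fps" where "q = 1 - 6 * fps_X + fps_X ^ 2"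
  have "3 * 2 ^ N * fps_nth (q * T) r =
      fps_nth (fps_const (2 ^ N) * (2 * (fps_of_poly (half_weight_poly D) * (q * T)) + fps_of_poly (half_weight_poly (dual n D)) * (q * T))) r"
    by (simp add: low_order_nth numeral_fps_const)
  also have "fps_const (2 ^ N) * (2 * (fps_of_poly (half_weight_poly D) * (q * T)) + fps_of_poly (half_weight_poly (dual n D)) * (q * T)) =
      q * (fps_const (2 ^ N) * (2 * fps_of_poly (half_weight_poly D) + fps_of_poly (half_weight_poly (dual n D)))) * T"
    by (simp only: distrib_left distrib_right mult_ac)
  also have "fps_nth \<dots> r = (if r \<le> N div 4 then 2 * (- 64) ^ r * of_nat (E r) else 0)"
    unfolding E T_def q_def mult.assoc[symmetric]
    using lagrange_extract[of "N div 4" "N" "\<lambda>j. 2 * (- 64) ^ j * of_nat (E j)" r]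
    by (simp only: mult.assoc[symmetric])
  finally have *: "3 * 2 ^ N * fps_nth (q * T) r = 2 * (- 64) ^ r * of_nat (if r \<le> N div 4 then E r else 0)"
    by simp
  show ?thesis
    by (rule that[OF *[unfolded T q_def]])
qed

end

subsection \<open>Bounds on the minimum distance\<close>

lemma wt_gt_of_min_dist_gt:
  assumes "\<not> min_dist (dual n D) \<le> b" "v \<in> dual n D" "v \<noteq> (\<lambda>_. 0)"
  shows "b < wt v"
proof -
  have "{wt v |v. v \<in> dual n D \<and> v \<noteq> (\<lambda>_. 0)} \<subseteq> wt ` dual n D" by blast
  then have "finite {wt v |v. v \<in> dual n D \<and> v \<noteq> (\<lambda>_. 0)}"
    using finite_dual finite_subset by blast
  then have "min_dist (dual n D) \<le> wt v"
    unfolding min_dist_def using assms by (intro Min_le) auto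
  with assms(1) show ?thesis by simp
qed

text \<open>A larger distance would equate a positive coefficient with a natural multiple of
  \<open>(- 64) ^ r\<close>, which is nonpositive for odd \<open>r\<close>.\<close>

lemma min_dist_le_if_odd:
  assumes "odd r" "N < 6 * r + 2"
  shows "min_dist (dual n D) \<le> 2 * r"
proof (rule ccontr)
  assume *: "\<not> min_dist (dual n D) \<le> 2 * r"
  define e where "e = 6 * r + 2 - N"
  have e: "6 * r + 2 = e + N" "e > 0" using assms(2) by (simp_all add: e_def)
  obtain E :: nat where
    "2 ^ N * fps_nth ((1 + fps_X) ^ e * even_geom (2 * r)) r = 4 * (- 64) ^ r * of_nat E"
  proof (rule diff_coefficient[OF _ e(1)])
    show "2 * r < wt v" if "v \<in> dual n D" "v \<noteq> (\<lambda>_. 0)" for v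
      using wt_gt_of_min_dist_gt[OF * that] .
  qed (rule that)
  moreover have "2 ^ N * fps_nth ((1 + fps_X) ^ e * even_geom (2 * r)) r > 0"
    using power_mult_even_geom_nth_pos[OF e(2)] by simp
  moreover have "4 * (- 64) ^ r * real E \<le> 0"
    using assms(1) by simp
  ultimately show False by linarith
qed

text \<open>For the even \<open>r = 2 * m + 2\<close> the sign contradiction comes from
  \<open>2 * G + F\<close>: the coefficient is negative, the expansion nonnegative. The values
  \<open>e = 2, 3, 4\<close> are the lengths \<open>24 * m + 20\<close>, \<open>24 * m + 18\<close>
  and \<open>24 * m + 16\<close>.\<close>

lemma min_dist_le_if_even:
  assumes "e \<in> {2, 3, 4}" "12 * m + 12 = e + N"
  shows "min_dist (dual n D) \<le> 4 * m + 4"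
proof (rule ccontr)
  assume "\<not> min_dist (dual n D) \<le> 4 * m + 4"
  then have *: "\<not> min_dist (dual n D) \<le> 2 * (2 * m + 2)" by simp
  have e: "6 * (2 * m + 2) = e + N" using assms(2) by simp
  obtain E :: nat where
    "3 * 2 ^ N * fps_nth ((1 - 6 * fps_X + fps_X ^ 2) * ((1 + fps_X) ^ e * even_geom (2 * (2 * m + 2)))) (2 * m + 2) =
     2 * (- 64) ^ (2 * m + 2) * of_nat E"
  proof (rule sum_coefficient[OF _ e])
    show "2 * (2 * m + 2) < wt v" if "v \<in> dual n D" "v \<noteq> (\<lambda>_. 0)" for v
      using wt_gt_of_min_dist_gt[OF * that] .
  qed (rule that)
  moreover have "3 * 2 ^ N * fps_nth ((1 - 6 * fps_X + fps_X ^ 2) * ((1 + fps_X) ^ e * even_geom (2 * (2 * m + 2)))) (2 * m + 2) < 0"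
  proof -
    have eq: "2 * (2 * m + 2) = 4 * m + 4" by simp
    show ?thesis
      unfolding eq by (rule mult_pos_neg[OF _ jacobian_mult_even_geom_nth_neg[OF assms(1)]]) simp
  qed
  moreover have "2 * (- 64) ^ (2 * m + 2) * real E \<ge> 0"
    by simp
  ultimately show False by linarith
qed

lemma shadow_eq_dual:
  assumes "doubly_even D"
  shows "shadow n D = dual n D"
proof -
  have "\<i> ^ wt v = 1" if "v \<in> D" for v
    using assms that by (auto simp: doubly_even_def power_mult elim!: dvdE)
  then show ?thesis
    by (auto simp: shadow_def dual_def inner_commute bit_sign_def split: if_splits)
qed

text \<open>A larger distance gives \<open>3 * ?b = 2 * E\<close>, so the binomial is even and
  \<open>D\<close> must be doubly-even. Then the shadow is the dual, whose nonzero words are too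
  heavy for \<open>E\<close> to be nonzero, although \<open>?b > 0\<close>.\<close>

lemma min_dist_le_if_length_24:
  assumes "n = 24 * \<mu>" and "doubly_even D \<or> odd ((5 * \<mu> - 1) choose (\<mu> - 1))"
  shows "min_dist (dual n D) \<le> 4 * \<mu>"
proof (rule ccontr)
  assume "\<not> min_dist (dual n D) \<le> 4 * \<mu>"
  then have *: "\<not> min_dist (dual n D) \<le> 2 * (2 * \<mu>)" by simp
  have N: "N = 12 * \<mu>" "\<mu> > 0" using assms(1) n_eq N_ge_2 by auto
  then have e: "6 * (2 * \<mu>) + 2 = 2 + N" by simp
  let ?b = "(5 * \<mu> - 1) choose (\<mu> - 1)"
  obtain E :: nat where
    E: "2 ^ N * fps_nth ((1 + fps_X) ^ 2 * even_geom (2 * (2 * \<mu>))) (2 * \<mu>) = 4 * (- 64) ^ (2 * \<mu>) * of_nat E"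
    and E0: "\<forall>u\<in>shadow n D. wt u mod 4 \<noteq> N mod 4 \<longrightarrow> (N - 2 - wt u) div 4 < 2 * \<mu> \<Longrightarrow> E = 0"
  proof (rule diff_coefficient[OF _ e])
    show "2 * (2 * \<mu>) < wt v" if "v \<in> dual n D" "v \<noteq> (\<lambda>_. 0)" for v
      using wt_gt_of_min_dist_gt[OF * that] .
  qed (rule that)
  \<comment> \<open>Both sides are \<open>2 ^ (12 * \<mu>)\<close>, so the powers cancel and an
    equation between integers remains.\<close>
  have "(2::real) ^ N = (- 64) ^ (2 * \<mu>)"
  proof -
    have "(2::real) ^ N = (2 ^ 12) ^ \<mu>"
      unfolding N(1) by (rule power_mult)
    then show ?thesis by (simp add: power_mult)
  qed
  then have "6 * real ?b = 4 * real E"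
    using E square_mult_even_geom_nth[OF N(2)] by simp
  then have bE: "3 * ?b = 2 * E" by linarith
  then have "even ?b" by presburger
  with assms(2) have "doubly_even D" by blast
  have "E = 0"
  proof (rule E0, intro ballI impI)
    fix u assume u: "u \<in> shadow n D" "wt u mod 4 \<noteq> N mod 4"
    then have "u \<in> dual n D" using shadow_eq_dual[OF \<open>doubly_even D\<close>] by simp
    \<comment> \<open>The zero vector has weight congruent to \<open>N = 12 * \<mu>\<close> modulo
      4, so it lies outside the class considered.\<close>
    moreover have "u \<noteq> (\<lambda>_. 0)" using u N by (auto simp: wt_def)
    ultimately have "4 * \<mu> < wt u" using wt_gt_of_min_dist_gt[OF *] by simp
    then show "(N - 2 - wt u) div 4 < 2 * \<mu>" using N by linarith
  qed
  moreover have "?b > 0" using N(2) by simp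
  ultimately show False using bE by simp
qed

end

theorem theorem2p1:
  fixes n :: nat and D :: "(nat \<Rightarrow> bit) set"
  assumes "semi_self_dual n D"
  shows "(n mod 24 \<in> {0,2,4,6,8,10,12,14} \<longrightarrow> min_dist (dual n D) \<le> 4 * (n div 24) + 2)
       \<and> (n mod 24 \<in> {16,18,20} \<longrightarrow> min_dist (dual n D) \<le> 4 * (n div 24) + 4)
       \<and> (n mod 24 = 22 \<longrightarrow> min_dist (dual n D) \<le> 4 * (n div 24) + 6)
       \<and> (\<forall>\<mu>::nat. n = 24 * \<mu> \<and> (doubly_even D \<or> odd ((5 * \<mu> - 1) choose (\<mu> - 1)))
             \<longrightarrow> min_dist (dual n D) \<le> 4 * \<mu>)"
proof -
  interpret semi_self_dual_code n D by unfold_locales (rule assms)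
  interpret semi_self_dual_half_length n D "n div 2"
    by unfold_locales (use even_n in simp)
  define m where "m = n div 24"
  have n: "n = 24 * m + n mod 24" by (simp add: m_def)
  have "(24 * m + k) div 2 = 12 * m + k div 2" for k by presburger
  then have half: "n div 2 = 12 * m + n mod 24 div 2" using n by metis
  show ?thesis
  proof (intro conjI impI allI)
    assume "n mod 24 \<in> {0,2,4,6,8,10,12,14}"
    then have "n mod 24 \<le> 14" by auto
    then have "n < (6 * (2 * m + 1) + 2) * 2" by (subst n) simp
    then have "n div 2 < 6 * (2 * m + 1) + 2" by (rule less_mult_imp_div_less)
    then have "min_dist (dual n D) \<le> 2 * (2 * m + 1)" by (intro min_dist_le_if_odd) auto
    then show "min_dist (dual n D) \<le> 4 * (n div 24) + 2" by (simp add: m_def)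
  next
    assume "n mod 24 \<in> {16,18,20}"
    then have "\<exists>e\<in>{2, 3, 4}. 12 * m + 12 = e + n div 2"
      using half by auto
    then have "min_dist (dual n D) \<le> 4 * m + 4" using min_dist_le_if_even by blast
    then show "min_dist (dual n D) \<le> 4 * (n div 24) + 4" by (simp add: m_def)
  next
    \<comment> \<open>Here \<open>r = 2 * m + 2\<close> would leave \<open>e = 1\<close>, outside
      the range of \<open>min_dist_le_if_even\<close>; the next odd value \<open>2 * m + 3\<close>
      is taken instead.\<close>
    assume "n mod 24 = 22"
    then have "n < (6 * (2 * m + 3) + 2) * 2" by (subst n) simp
    then have "n div 2 < 6 * (2 * m + 3) + 2" by (rule less_mult_imp_div_less)
    then have "min_dist (dual n D) \<le> 2 * (2 * m + 3)" by (intro min_dist_le_if_odd) auto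
    then show "min_dist (dual n D) \<le> 4 * (n div 24) + 6" by (simp add: m_def)
  next
    fix \<mu> assume "n = 24 * \<mu> \<and> (doubly_even D \<or> odd ((5 * \<mu> - 1) choose (\<mu> - 1)))"
    then show "min_dist (dual n D) \<le> 4 * \<mu>" using min_dist_le_if_length_24 by blast
  qed
qed

end
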